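(* Let $H$ be a countable (finite or infinite) subgroup of an infinite Abelian group $G$. If there is an element $e_0\in G$ of infinite order such that $\langle e_0\rangle\cap H=\{0\}$, then $H\in\mathcal{NRC}(G)$.
   Context: $\langle e_0\rangle$ is the subgroup generated by $e_0$. For a topological Abelian group $X$, $X^\wedge$ is the group of continuous characters (continuous homomorphisms to the circle group), and $\mathbf{n}(X)=\bigcap_{\chi\in X^\wedge}\ker\chi$ is the von Neumann radical of $X$. For an infinite Abelian group $G$, $\mathcal{NRC}(G)$ is the set of all subgroups $H$ of $G$ for which there exists a complete non-discrete Hausdorff group topology $\tau$ on $G$ with $\mathbf{n}(G,\tau)=H$. *)

theory Defs
  imports "HOL-Analysis.Analysis" "HOL-Algebra.Multiplicative_Group"
begin

text \<open>Abelian groups are written multiplicatively, following HOL-Algebra.\<close>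

definition group_topology :: "('a, 'b) monoid_scheme \<Rightarrow> 'a topology \<Rightarrow> bool" where
  "group_topology G \<tau> \<longleftrightarrow>
     topspace \<tau> = carrier G \<and>
     continuous_map (prod_topology \<tau> \<tau>) \<tau> (\<lambda>(x, y). x \<otimes>\<^bsub>G\<^esub> y) \<and>
     continuous_map \<tau> \<tau> (\<lambda>x. inv\<^bsub>G\<^esub> x)"

text \<open>
  The class-based notions \<open>cauchy_filter\<close> and \<open>complete\<close> do not apply to a topology that varies
  on a fixed carrier, so they are restated for the uniformity of a topological group. For an
  Abelian group the left and right uniformities coincide.
\<close>

definition group_cauchy_filter ::
  "('a, 'b) monoid_scheme \<Rightarrow> 'a topology \<Rightarrow> 'a filter \<Rightarrow> bool" where
  "group_cauchy_filter G \<tau> F \<longleftrightarrow>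
     filterlim (\<lambda>(x, y). x \<otimes>\<^bsub>G\<^esub> inv\<^bsub>G\<^esub> y) (nhdsin \<tau> \<one>\<^bsub>G\<^esub>) (F \<times>\<^sub>F F)"

definition complete_group_topology :: "('a, 'b) monoid_scheme \<Rightarrow> 'a topology \<Rightarrow> bool" where
  "complete_group_topology G \<tau> \<longleftrightarrow>
     (\<forall>F \<le> principal (carrier G). F \<noteq> bot \<longrightarrow> group_cauchy_filter G \<tau> F \<longrightarrow>
        (\<exists>x \<in> carrier G. F \<le> nhdsin \<tau> x))"

definition circle_group :: "complex monoid" where
  "circle_group = \<lparr>carrier = sphere 0 1, mult = (*), one = 1\<rparr>"

lemma comm_group_circle_group: "comm_group circle_group"
proof (rule comm_groupI)
  fix x assume "x \<in> carrier circle_group"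
  then have "cmod x = 1" "x \<noteq> 0"
    by (auto simp: circle_group_def)
  then show "\<exists>y\<in>carrier circle_group. y \<otimes>\<^bsub>circle_group\<^esub> x = \<one>\<^bsub>circle_group\<^esub>"
    by (intro bexI[of _ "inverse x"]) (auto simp: circle_group_def norm_inverse)
qed (auto simp: circle_group_def norm_mult)

definition continuous_characters ::
  "('a, 'b) monoid_scheme \<Rightarrow> 'a topology \<Rightarrow> ('a \<Rightarrow> complex) set" where
  "continuous_characters G \<tau> =
     {f \<in> hom G circle_group. continuous_map \<tau> (top_of_set (carrier circle_group)) f}"

definition von_neumann_radical :: "('a, 'b) monoid_scheme \<Rightarrow> 'a topology \<Rightarrow> 'a set" where
  "von_neumann_radical G \<tau> = (\<Inter>f \<in> continuous_characters G \<tau>. kernel G circle_group f)"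

definition NRC :: "('a, 'b) monoid_scheme \<Rightarrow> 'a set set" where
  "NRC G = {H. subgroup H G \<and>
     (\<exists>\<tau>. group_topology G \<tau> \<and> Hausdorff_space \<tau> \<and> complete_group_topology G \<tau> \<and>
        \<tau> \<noteq> discrete_topology (carrier G) \<and> von_neumann_radical G \<tau> = H)}"

end

theory Submission
  imports Defs
begin

text \<open>
  Choose a sequence \<open>h n\<close> in \<open>H\<close> that takes every value infinitely often, and finite sums
  \<open>S n = spread_sum n\<close> of powers of two: the sum \<open>S n\<close> has \<open>n + 1\<close> terms, their exponents are all
  at least \<open>n\<close> and lie at distance \<open>2 n\<close> from one another. Let \<open>e\<close> be the given element of infinite
  order, and give \<open>G\<close> the finest group topology in which both
    \<open>e [^] (2 ^ j) \<longlonglongrightarrow> \<one>\<close> and \<open>h n \<otimes> e [^] S n \<longlonglongrightarrow> \<one>\<close>.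

  A continuous character \<open>f\<close> satisfies \<open>f e ^ (2 ^ j) \<longlonglongrightarrow> 1\<close>. On the circle this is possible only if
  \<open>f e ^ (2 ^ m) = 1\<close> for some \<open>m\<close>, because squaring expands distances near \<open>1\<close>. Since \<open>2 ^ m\<close> divides \<open>S n\<close>
  for \<open>n \<ge> m\<close>, the second limit becomes \<open>f (h n) \<longlonglongrightarrow> 1\<close>, and recurrence of \<open>h\<close> forces \<open>f = 1\<close> on \<open>H\<close>.
  Conversely, a character that is trivial on \<open>H\<close> and on \<open>e [^] (2 ^ m)\<close> is trivial on a neighbourhood of \<open>1\<close>,
  hence continuous. The subgroups generated by \<open>H\<close> and \<open>e [^] (2 ^ m)\<close> intersect in \<open>H\<close>, as \<open>e\<close> is independent of
  \<open>H\<close>, and characters separate points from subgroups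
  (\<open>character_separating_subgroup_from_point\<close>). So the radical is exactly \<open>H\<close>.

  The same subgroups separate the points outside \<open>H\<close> from \<open>1\<close>. For the points of \<open>H\<close> one
  neighbourhood of \<open>1\<close> suffices that meets \<open>H\<close> only in \<open>1\<close>: in a product of few factors
  \<open>e [^] (2 ^ j)\<close>, \<open>h n \<otimes> e [^] S n\<close> and their inverses that lies in \<open>H\<close> the exponent of \<open>e\<close> vanishes, but a multiple of \<open>S n\<close>
  has too many isolated binary digits to be cancelled by few powers of two
  (\<open>sparse_relation_trivial\<close>); hence the factors \<open>h n\<close> cancel as well.

  Completeness holds for every topology of this type (\<open>complete_base_topology\<close>). Up to a
  translation, the open subgroup generated by the sequences is a countable union of compact sets:
  the sets of products of at most \<open>n\<close> members. A Cauchy filter cannot stay away from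
  all of them: diagonalising over the witnesses gives a neighbourhood of \<open>1\<close> in which it is not
  small. And a Cauchy filter that does not stay away from one of these compact sets has a limit in it.
\<close>

section \<open>Extending characters of Abelian groups\<close>

lemma group_circle_group: "group circle_group"
  using comm_group_circle_group by (simp add: comm_group_def)

lemma circle_group_nat_pow: "z [^]\<^bsub>circle_group\<^esub> (n::nat) = z ^ n"
  by (induction n) (simp_all add: circle_group_def nat_pow_def)

lemma circle_group_root:
  assumes "w \<in> carrier circle_group" and "n > (0::nat)"
  obtains z where "z \<in> carrier circle_group" and "z [^]\<^bsub>circle_group\<^esub> n = w"
proof -
  obtain z where z: "w = z ^ n"
    using assms(2) by (metis exists_complex_root not_gr_zero)
  have "cmod z ^ n = 1"
    using assms(1) by (simp add: circle_group_def z norm_power)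
  then have "cmod z = 1"
    using assms(2) power_eq_imp_eq_base[of "cmod z" n 1] by simp
  then show thesis
    using that z by (simp add: circle_group_nat_pow) (simp add: circle_group_def)
qed

lemma circle_group_nontrivial_root_of_one:
  assumes "n \<noteq> (1::nat)"
  obtains z where "z \<in> carrier circle_group" and "z \<noteq> 1" and "z [^]\<^bsub>circle_group\<^esub> n = 1"
proof (cases "n = 0")
  case True
  then show thesis
    using that[of "-1"] by (simp add: circle_group_nat_pow) (simp add: circle_group_def)
next
  case False
  have "\<not> {z::complex. z ^ n = 1} \<subseteq> {1}"
    using card_mono[of "{1::complex}" "{z. z ^ n = 1}"] card_roots_unity_eq[of n] False assms by auto
  then obtain z :: complex where z: "z ^ n = 1" "z \<noteq> 1"
    by blast
  then have "cmod z ^ n = 1"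
    by (metis norm_one norm_power)
  then have "cmod z = 1"
    using False power_eq_imp_eq_base[of "cmod z" n 1] by simp
  then show thesis
    using that z by (simp add: circle_group_nat_pow) (simp add: circle_group_def)
qed

text \<open>
  The exponents form a subgroup of the integers, hence are the multiples of one number \<open>d\<close>; the
  value \<open>d = 0\<close> covers the case that \<open>x\<close> is independent of \<open>K\<close>.
\<close>

lemma (in group) exponents_in_subgroup_are_multiples:
  assumes K: "subgroup K G" and x: "x \<in> carrier G"
  obtains d :: nat where "\<And>n::int. x [^] n \<in> K \<longleftrightarrow> int d dvd n"
proof -
  define pos where "pos n \<longleftrightarrow> n > 0 \<and> x [^] n \<in> K" for n :: nat
  show thesis
  proof (cases "\<exists>n. pos n")
    case False
    have "n = 0" if n: "x [^] n \<in> K" for n :: int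
    proof (rule ccontr)
      assume "n \<noteq> 0"
      have "x [^] (- n) \<in> K"
        using x subgroup.m_inv_closed[OF K n] by (simp add: int_pow_neg)
      then have "x [^] int (nat \<bar>n\<bar>) \<in> K"
        using n by (cases "n \<ge> 0") simp_all
      then have "pos (nat \<bar>n\<bar>)"
        using \<open>n \<noteq> 0\<close> unfolding pos_def int_pow_int by simp
      then show False
        using False by blast
    qed
    then have "x [^] n \<in> K \<longleftrightarrow> int 0 dvd n" for n :: int
      using subgroup.one_closed[OF K] by auto
    then show ?thesis
      using that by blast
  next
    case True
    define d where "d = (LEAST n. pos n)"
    have "pos d"
      using True unfolding d_def by (rule LeastI_ex)
    then have d: "d > 0" "x [^] d \<in> K"
      by (auto simp: pos_def)
    have mult: "x [^] (int d * q) \<in> K" for q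
      using subgroup_int_pow_closed[OF K d(2), of q] x by (simp add: int_pow_pow flip: int_pow_int)
    have "int d dvd n" if n: "x [^] n \<in> K" for n :: int
    proof -
      define q r where "q = n div int d" and "r = nat (n mod int d)"
      have r: "r < d" and nqr: "n = int r + int d * q"
        using d by (simp_all add: q_def r_def nat_less_iff)
      have "x [^] n \<otimes> inv (x [^] (int d * q)) \<in> K"
        using K n mult by (simp add: subgroup.m_closed subgroup.m_inv_closed)
      also have "x [^] n \<otimes> inv (x [^] (int d * q)) = x [^] r"
        using x by (simp add: nqr int_pow_diff[symmetric] flip: int_pow_int)
      finally have "\<not> r > 0"
        using r not_less_Least[of r pos] by (auto simp: pos_def d_def)
      then show ?thesis
        using nqr by simp
    qed
    then show ?thesis
      using that[of d] mult by (auto elim!: dvdE)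
  qed
qed

text \<open>
  The graph of a character of some subgroup. Coding it as a subgroup of the product with the
  circle makes unions of chains and one-step extensions immediate; the condition over \<open>\<one>\<close> says
  that the relation is single-valued.
\<close>

definition partial_character :: "('a, 'b) monoid_scheme \<Rightarrow> ('a \<times> complex) set \<Rightarrow> bool" where
  "partial_character G R \<longleftrightarrow> subgroup R (G \<times>\<times> circle_group) \<and> (\<forall>z. (\<one>\<^bsub>G\<^esub>, z) \<in> R \<longrightarrow> z = 1)"

context comm_group
begin

lemma comm_group_DirProd_circle: "comm_group (G \<times>\<times> circle_group)"
proof -
  interpret T: comm_group circle_group by (rule comm_group_circle_group)
  show ?thesis
    by (rule group.group_comm_groupI)
      (auto simp: DirProd_group group_circle_group is_group m_comm T.m_comm)
qed

lemma partial_character_single_valued: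
  assumes "partial_character G R" and "(x, z) \<in> R" and "(x, w) \<in> R"
  shows "z = w"
proof -
  interpret T: comm_group circle_group by (rule comm_group_circle_group)
  interpret P: comm_group "G \<times>\<times> circle_group" by (rule comm_group_DirProd_circle)
  have R: "subgroup R (G \<times>\<times> circle_group)"
    using assms by (simp add: partial_character_def)
  have c: "x \<in> carrier G" "z \<in> carrier circle_group" "w \<in> carrier circle_group"
    using subgroup.subset[OF R] assms(2,3) by auto
  have "(x, z) \<otimes>\<^bsub>G \<times>\<times> circle_group\<^esub> inv\<^bsub>G \<times>\<times> circle_group\<^esub> (x, w) \<in> R"
    using R assms(2,3) by (simp add: subgroup.m_closed subgroup.m_inv_closed)
  then have "(\<one>, z \<otimes>\<^bsub>circle_group\<^esub> inv\<^bsub>circle_group\<^esub> w) \<in> R"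
    using c by (simp add: inv_DirProd[OF is_group group_circle_group])
  then have "z \<otimes>\<^bsub>circle_group\<^esub> inv\<^bsub>circle_group\<^esub> w = \<one>\<^bsub>circle_group\<^esub>"
    using assms(1) by (auto simp: partial_character_def circle_group_def)
  then show ?thesis
    using c by (metis T.inv_equality T.inv_inv T.inv_closed)
qed


lemma int_pow_DirProd_circle:
  assumes "x \<in> carrier G" and "z \<in> carrier circle_group"
  shows "(x, z) [^]\<^bsub>G \<times>\<times> circle_group\<^esub> (k::int) = (x [^] k, z [^]\<^bsub>circle_group\<^esub> k)"
proof -
  interpret T: comm_group circle_group by (rule comm_group_circle_group)
  interpret P: comm_group "G \<times>\<times> circle_group" by (rule comm_group_DirProd_circle)
  have "(x, z) [^]\<^bsub>G \<times>\<times> circle_group\<^esub> n = (x [^] n, z [^]\<^bsub>circle_group\<^esub> n)" for n :: nat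
    by (induction n) auto
  moreover have "x [^] n \<in> carrier G" "z [^]\<^bsub>circle_group\<^esub> n \<in> carrier circle_group" for n :: nat
    using assms by auto
  ultimately show ?thesis
    by (cases "k < 0") (simp_all only: int_pow_def2 if_True if_False inv_DirProd[OF is_group group_circle_group])
qed

text \<open>
  The only obstruction to prescribing the value \<open>z\<close> at \<open>x\<close> comes from the powers of \<open>x\<close> that are
  already in the domain.
\<close>

lemma partial_character_extend_by_element:
  assumes R: "partial_character G R" and x: "x \<in> carrier G" and z: "z \<in> carrier circle_group"
    and compat: "\<And>(n::int) w. (x [^] n, w) \<in> R \<Longrightarrow> w = z [^]\<^bsub>circle_group\<^esub> n"
  obtains R' where "partial_character G R'" and "R \<subseteq> R'" and "(x, z) \<in> R'"
proof -
  interpret T: comm_group circle_group by (rule comm_group_circle_group)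
  interpret P: comm_group "G \<times>\<times> circle_group" by (rule comm_group_DirProd_circle)
  have R': "subgroup R (G \<times>\<times> circle_group)"
    using R by (simp add: partial_character_def)
  have xz: "(x, z) \<in> carrier (G \<times>\<times> circle_group)"
    using x z by simp
  define C where "C = generate (G \<times>\<times> circle_group) {(x, z)}"
  have C: "subgroup C (G \<times>\<times> circle_group)"
    unfolding C_def using xz by (intro P.generate_is_subgroup) auto
  let ?S = "R <#>\<^bsub>G \<times>\<times> circle_group\<^esub> C"
  have sub: "subgroup ?S (G \<times>\<times> circle_group)"
    by (rule P.mult_subgroups[OF R' C])
  have "w' = 1" if "(\<one>, w') \<in> ?S" for w'
  proof -
    from that obtain l w c where lw: "(l, w) \<in> R" and c: "c \<in> C"
      and eq: "(\<one>, w') = (l, w) \<otimes>\<^bsub>G \<times>\<times> circle_group\<^esub> c"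
      by (auto simp: set_mult_def)
    obtain k :: int where k: "c = (x [^] k, z [^]\<^bsub>circle_group\<^esub> k)"
      using c P.generate_pow[OF xz] int_pow_DirProd_circle[OF x z] by (auto simp: C_def)
    have cl: "l \<in> carrier G" "w \<in> carrier circle_group"
      using subgroup.subset[OF R'] lw by auto
    have e: "\<one> = l \<otimes> x [^] k" "w' = w \<otimes>\<^bsub>circle_group\<^esub> z [^]\<^bsub>circle_group\<^esub> k"
      using eq k by auto
    have "l = x [^] (-k)"
      using e(1) cl x by (metis int_pow_closed int_pow_neg inv_equality)
    then have "w = z [^]\<^bsub>circle_group\<^esub> (-k)"
      using compat lw by blast
    then show ?thesis
      using e(2) z by (simp add: T.int_pow_neg) (simp add: circle_group_def)
  qed
  then have "partial_character G ?S"
    using sub by (simp add: partial_character_def)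
  moreover have "R \<subseteq> ?S"
  proof
    fix r assume r: "r \<in> R"
    have "r \<otimes>\<^bsub>G \<times>\<times> circle_group\<^esub> \<one>\<^bsub>G \<times>\<times> circle_group\<^esub> \<in> ?S"
      using r subgroup.one_closed[OF C] unfolding set_mult_def by blast
    then show "r \<in> ?S"
      using r subgroup.subset[OF R'] by (metis P.r_one subsetD)
  qed
  moreover have "(x, z) \<in> ?S"
  proof -
    have "\<one>\<^bsub>G \<times>\<times> circle_group\<^esub> \<otimes>\<^bsub>G \<times>\<times> circle_group\<^esub> (x, z) \<in> ?S"
      using subgroup.one_closed[OF R'] generate.incl[of "(x, z)" "{(x, z)}" "G \<times>\<times> circle_group"]
      unfolding set_mult_def C_def by blast
    then show ?thesis
      using P.l_one[OF xz] by simp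
  qed
  ultimately show thesis
    using that by blast
qed

text \<open>
  This is where divisibility of the circle enters: if \<open>x\<^sup>d\<close> generates the powers of \<open>x\<close> in the domain,
  any \<open>d\<close>-th root of the value at \<open>x\<^sup>d\<close> will do.
\<close>

lemma compatible_root_exists:
  assumes R: "partial_character G R" and x: "x \<in> carrier G"
  obtains z where "z \<in> carrier circle_group"
    and "\<And>(n::int) w. (x [^] n, w) \<in> R \<Longrightarrow> w = z [^]\<^bsub>circle_group\<^esub> n"
proof -
  interpret T: comm_group circle_group by (rule comm_group_circle_group)
  interpret P: comm_group "G \<times>\<times> circle_group" by (rule comm_group_DirProd_circle)
  have R': "subgroup R (G \<times>\<times> circle_group)" and one: "\<And>z. (\<one>, z) \<in> R \<Longrightarrow> z = 1"
    using R by (auto simp: partial_character_def)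
  have T_cl: "w \<in> carrier circle_group" if "(y, w) \<in> R" for y w
    using subgroup.subset[OF R'] that by auto
  have "subgroup (fst ` R) G"
  proof (rule subgroupI)
    show "fst ` R \<subseteq> carrier G"
      using subgroup.subset[OF R'] by auto
    show "fst ` R \<noteq> {}"
      using subgroup.one_closed[OF R'] by auto
    show "inv a \<in> fst ` R" if "a \<in> fst ` R" for a
    proof -
      obtain w where w: "(a, w) \<in> R"
        using \<open>a \<in> fst ` R\<close> by force
      then have "a \<in> carrier G" "w \<in> carrier circle_group"
        using subgroup.subset[OF R'] by auto
      then have "(inv a, inv\<^bsub>circle_group\<^esub> w) \<in> R"
        using subgroup.m_inv_closed[OF R' w] by (simp add: inv_DirProd[OF is_group group_circle_group])
      then show ?thesis
        by force
    qed
    show "a \<otimes> b \<in> fst ` R" if ab: "a \<in> fst ` R" "b \<in> fst ` R" for a b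
    proof -
      obtain v w where "(a, v) \<in> R" "(b, w) \<in> R"
        using ab by force
      then have "(a \<otimes> b, v \<otimes>\<^bsub>circle_group\<^esub> w) \<in> R"
        using subgroup.m_closed[OF R', of "(a, v)" "(b, w)"] by simp
      then show ?thesis
        by force
    qed
  qed
  then obtain d where "\<And>n::int. x [^] n \<in> fst ` R \<longleftrightarrow> int d dvd n"
    using exponents_in_subgroup_are_multiples x by blast
  moreover have "y \<in> fst ` R \<longleftrightarrow> (\<exists>w. (y, w) \<in> R)" for y
    by force
  ultimately have d: "(\<exists>w. (x [^] n, w) \<in> R) \<longleftrightarrow> int d dvd n" for n :: int
    by simp
  then obtain v where "(x [^] int d, v) \<in> R"
    using d[THEN iffD2, OF dvd_refl] by blast
  then have v: "(x [^] d, v) \<in> R"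
    by (simp add: int_pow_int)
  have "\<exists>z \<in> carrier circle_group. z [^]\<^bsub>circle_group\<^esub> d = v"
  proof (cases "d = 0")
    case True
    then have "v = 1"
      using v one by simp
    then show ?thesis
      using True by (intro bexI[of _ "\<one>\<^bsub>circle_group\<^esub>"]) (auto simp: circle_group_def)
  next
    case False
    then show ?thesis
      using circle_group_root[OF T_cl[OF v]] by blast
  qed
  then obtain z where z: "z \<in> carrier circle_group" and zd: "z [^]\<^bsub>circle_group\<^esub> d = v"
    by blast
  have "w = z [^]\<^bsub>circle_group\<^esub> n" if nw: "(x [^] n, w) \<in> R" for n :: int and w
  proof -
    obtain q where q: "n = int d * q"
      using d nw by (metis dvdE)
    have "(x [^] n, v [^]\<^bsub>circle_group\<^esub> q) \<in> R"
      using P.subgroup_int_pow_closed[OF R' v, of q] x T_cl[OF v]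
      by (simp add: q int_pow_DirProd_circle int_pow_pow flip: int_pow_int)
    then have "w = v [^]\<^bsub>circle_group\<^esub> q"
      using partial_character_single_valued[OF R] nw by blast
    also have "\<dots> = z [^]\<^bsub>circle_group\<^esub> n"
      using z by (simp add: q T.int_pow_pow flip: zd int_pow_int)
    finally show ?thesis .
  qed
  then show thesis
    using that z by blast
qed

text \<open>
  Zorn's lemma: a maximal extension has full domain, since otherwise it could be extended by
  one more element.
\<close>

lemma maximal_partial_character_exists:
  assumes R0: "partial_character G R0"
  obtains R where "partial_character G R" and "R0 \<subseteq> R" and "fst ` R = carrier G"
proof -
  interpret P: comm_group "G \<times>\<times> circle_group" by (rule comm_group_DirProd_circle)
  define \<A> where "\<A> = {R. partial_character G R \<and> R0 \<subseteq> R}"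
  have "\<exists>R\<in>\<A>. \<forall>X\<in>\<A>. R \<subseteq> X \<longrightarrow> X = R"
  proof (rule subset_Zorn_nonempty)
    show "\<A> \<noteq> {}"
      using R0 by (auto simp: \<A>_def)
    fix \<C> assume ne: "\<C> \<noteq> {}" and chain: "subset.chain \<A> \<C>"
    have sub: "subgroup R (G \<times>\<times> circle_group)" if "R \<in> \<C>" for R
      using chain that by (auto simp: subset_chain_def \<A>_def partial_character_def)
    have "subgroup (\<Union>\<C>) (G \<times>\<times> circle_group)"
    proof (rule P.subgroupI)
      show "\<Union>\<C> \<subseteq> carrier (G \<times>\<times> circle_group)"
        using subgroup.subset[OF sub] by blast
      show "\<Union>\<C> \<noteq> {}"
        using ne subgroup.one_closed[OF sub] by blast
      show "inv\<^bsub>G \<times>\<times> circle_group\<^esub> a \<in> \<Union>\<C>" if "a \<in> \<Union>\<C>" for a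
        using that subgroup.m_inv_closed[OF sub] by blast
      show "a \<otimes>\<^bsub>G \<times>\<times> circle_group\<^esub> b \<in> \<Union>\<C>" if ab: "a \<in> \<Union>\<C>" "b \<in> \<Union>\<C>" for a b
      proof -
        obtain X Y where XY: "X \<in> \<C>" "Y \<in> \<C>" "a \<in> X" "b \<in> Y"
          using ab by blast
        have "X \<subseteq> Y \<or> Y \<subseteq> X"
          using chain XY(1,2) by (simp add: subset_chain_def)
        then consider "X \<subseteq> Y" | "Y \<subseteq> X"
          by blast
        then show ?thesis
        proof cases
          case 1
          then show ?thesis
            using subgroup.m_closed[OF sub[OF XY(2)], of a b] XY by blast
        next
          case 2
          then show ?thesis
            using subgroup.m_closed[OF sub[OF XY(1)], of a b] XY by blast
        qed
      qed
    qed
    moreover have "z = 1" if "(\<one>, z) \<in> \<Union>\<C>" for z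
      using that chain by (auto simp: \<A>_def subset_chain_def partial_character_def)
    moreover have "R0 \<subseteq> \<Union>\<C>"
    proof -
      obtain R where "R \<in> \<C>"
        using ne by blast
      moreover from this have "R0 \<subseteq> R"
        using chain by (auto simp: \<A>_def subset_chain_def)
      ultimately show ?thesis
        by blast
    qed
    ultimately show "\<Union>\<C> \<in> \<A>"
      by (simp add: \<A>_def partial_character_def)
  qed
  then obtain R where RA: "R \<in> \<A>" and maxA: "\<And>X. X \<in> \<A> \<Longrightarrow> R \<subseteq> X \<Longrightarrow> X = R"
    by blast
  then have R: "partial_character G R" "R0 \<subseteq> R"
    by (auto simp: \<A>_def)
  have max: "X = R" if "partial_character G X" "R \<subseteq> X" for X
    using that R(2) by (intro maxA) (auto simp: \<A>_def)
  have "carrier G \<subseteq> fst ` R"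
  proof
    fix x assume x: "x \<in> carrier G"
    obtain z where z: "z \<in> carrier circle_group"
      and compat: "\<And>(n::int) w. (x [^] n, w) \<in> R \<Longrightarrow> w = z [^]\<^bsub>circle_group\<^esub> n"
      using compatible_root_exists[OF R(1) x] by blast
    obtain R' where "partial_character G R'" "R \<subseteq> R'" "(x, z) \<in> R'"
      using partial_character_extend_by_element[OF R(1) x z compat] by blast
    then have "(x, z) \<in> R"
      using max[of R'] by simp
    then show "x \<in> fst ` R"
      by force
  qed
  moreover have "fst ` R \<subseteq> carrier G"
    using R(1) by (auto simp: partial_character_def dest!: subgroup.subset)
  ultimately show thesis
    using that R by blast
qed

text \<open>
  Extend the trivial character of \<open>K\<close> first to \<open>g\<close>, with a value other than \<open>1\<close>, and then to all
  of \<open>G\<close>. If \<open>d\<close> is the order of \<open>g\<close> modulo \<open>K\<close>, a nontrivial \<open>d\<close>-th root of unity is an admissible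
  value.
\<close>

theorem character_separating_subgroup_from_point:
  assumes K: "subgroup K G" and g: "g \<in> carrier G" "g \<notin> K"
  obtains \<phi> where "\<phi> \<in> hom G circle_group" and "\<And>x. x \<in> K \<Longrightarrow> \<phi> x = 1" and "\<phi> g \<noteq> 1"
proof -
  interpret T: comm_group circle_group by (rule comm_group_circle_group)
  interpret P: comm_group "G \<times>\<times> circle_group" by (rule comm_group_DirProd_circle)
  have one: "\<one>\<^bsub>circle_group\<^esub> = 1"
    by (simp add: circle_group_def)
  have "subgroup (K \<times> {\<one>\<^bsub>circle_group\<^esub>}) (G \<times>\<times> circle_group)"
    using K by (intro DirProd_subgroups is_group group_circle_group T.triv_subgroup)
  then have pc: "partial_character G (K \<times> {1})"
    by (simp add: partial_character_def one)
  obtain d where d: "\<And>n::int. g [^] n \<in> K \<longleftrightarrow> int d dvd n"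
    using exponents_in_subgroup_are_multiples[OF K g(1)] by blast
  then have "d \<noteq> 1"
    using d[of 1] g by auto
  then obtain z where z: "z \<in> carrier circle_group" "z \<noteq> 1" and zd: "z [^]\<^bsub>circle_group\<^esub> d = 1"
    using circle_group_nontrivial_root_of_one by blast
  have zK: "z [^]\<^bsub>circle_group\<^esub> n = 1" if "g [^] n \<in> K" for n :: int
  proof -
    obtain q where "n = int d * q"
      using d \<open>g [^] n \<in> K\<close> by blast
    then have "z [^]\<^bsub>circle_group\<^esub> n = (z [^]\<^bsub>circle_group\<^esub> d) [^]\<^bsub>circle_group\<^esub> q"
      using z(1) by (simp add: T.int_pow_pow flip: int_pow_int)
    then show ?thesis
      using zd T.int_pow_one[of q] by (simp add: one)
  qed
  obtain R1 where R1: "partial_character G R1" "K \<times> {1} \<subseteq> R1" "(g, z) \<in> R1"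
  proof (rule partial_character_extend_by_element[OF pc g(1) z(1)])
    show "w = z [^]\<^bsub>circle_group\<^esub> n" if "(g [^] n, w) \<in> K \<times> {1}" for n :: int and w
      using that zK by simp
  qed
  obtain R where R: "partial_character G R" "R1 \<subseteq> R" and dom: "fst ` R = carrier G"
    using maximal_partial_character_exists[OF R1(1)] by blast
  have R': "subgroup R (G \<times>\<times> circle_group)"
    using R by (simp add: partial_character_def)
  define \<phi> where "\<phi> x = (THE z. (x, z) \<in> R)" for x
  have \<phi>_eq: "\<phi> x = z" if "(x, z) \<in> R" for x z
    unfolding \<phi>_def
    by (rule the_equality) (use that partial_character_single_valued[OF R(1)] in \<open>simp_all\<close>)
  have \<phi>: "(x, \<phi> x) \<in> R" if "x \<in> carrier G" for x
  proof -
    have "x \<in> fst ` R"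
      using that dom by simp
    then obtain w where "(x, w) \<in> R"
      by auto
    then show ?thesis
      using \<phi>_eq[of x w] by simp
  qed
  show thesis
  proof (rule that[of \<phi>])
    show "\<phi> \<in> hom G circle_group"
    proof (rule homI)
      show "\<phi> x \<in> carrier circle_group" if "x \<in> carrier G" for x
        using \<phi>[OF that] subgroup.subset[OF R'] by auto
      show "\<phi> (x \<otimes> y) = \<phi> x \<otimes>\<^bsub>circle_group\<^esub> \<phi> y" if "x \<in> carrier G" "y \<in> carrier G" for x y
        using subgroup.m_closed[OF R' \<phi>[OF that(1)] \<phi>[OF that(2)]] by (auto intro: \<phi>_eq)
    qed
    show "\<phi> x = 1" if "x \<in> K" for x
      using that R1(2) R(2) by (intro \<phi>_eq) blast
    show "\<phi> g \<noteq> 1"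
      using \<phi>_eq[of g z] R1(3) R(2) z(2) by blast
  qed
qed

end

section \<open>Group topologies from neighbourhoods of the identity\<close>

locale group_nbhd_base = comm_group G for G (structure) +
  fixes U :: "'i \<Rightarrow> 'a set"
  assumes U_subset: "U i \<subseteq> carrier G"
    and one_in_U: "\<one> \<in> U i"
    and inv_in_U: "x \<in> U i \<Longrightarrow> inv x \<in> U i"
    and U_inter: "\<exists>k. U k \<subseteq> U i \<inter> U j"
    and U_mult: "\<exists>j. U j <#> U j \<subseteq> U i"
begin

definition base_topology :: "'a topology" where
  "base_topology = topology (\<lambda>W. W \<subseteq> carrier G \<and> (\<forall>x\<in>W. \<exists>i. x <# U i \<subseteq> W))"

lemma in_U_carrier: "u \<in> U i \<Longrightarrow> u \<in> carrier G"
  using U_subset by blast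

lemma openin_base_topology:
  "openin base_topology W \<longleftrightarrow> W \<subseteq> carrier G \<and> (\<forall>x\<in>W. \<exists>i. x <# U i \<subseteq> W)"
proof -
  have "istopology (\<lambda>W. W \<subseteq> carrier G \<and> (\<forall>x\<in>W. \<exists>i. x <# U i \<subseteq> W))"
    unfolding istopology_def
  proof (rule conjI; intro allI impI)
    fix S T assume S: "S \<subseteq> carrier G \<and> (\<forall>x\<in>S. \<exists>i. x <# U i \<subseteq> S)"
      and T: "T \<subseteq> carrier G \<and> (\<forall>x\<in>T. \<exists>i. x <# U i \<subseteq> T)"
    have "\<exists>i. x <# U i \<subseteq> S \<inter> T" if "x \<in> S \<inter> T" for x
    proof -
      obtain i j where ij: "x <# U i \<subseteq> S" "x <# U j \<subseteq> T"
        using S T \<open>x \<in> S \<inter> T\<close> by blast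
      obtain k where "U k \<subseteq> U i \<inter> U j"
        using U_inter by blast
      then have "x <# U k \<subseteq> S \<inter> T"
        using ij unfolding l_coset_def by blast
      then show ?thesis ..
    qed
    then show "S \<inter> T \<subseteq> carrier G \<and> (\<forall>x\<in>S \<inter> T. \<exists>i. x <# U i \<subseteq> S \<inter> T)"
      using S by auto
  next
    fix \<K> assume K: "\<forall>S\<in>\<K>. S \<subseteq> carrier G \<and> (\<forall>x\<in>S. \<exists>i. x <# U i \<subseteq> S)"
    have "\<exists>i. x <# U i \<subseteq> \<Union>\<K>" if x: "x \<in> \<Union>\<K>" for x
    proof -
      obtain S where "S \<in> \<K>" "x \<in> S"
        using x by blast
      then show ?thesis
        using K by (meson Sup_upper order_trans)
    qed
    then show "\<Union>\<K> \<subseteq> carrier G \<and> (\<forall>x\<in>\<Union>\<K>. \<exists>i. x <# U i \<subseteq> \<Union>\<K>)"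
      using K by (simp add: Sup_le_iff)
  qed
  then show ?thesis
    unfolding base_topology_def by (simp add: topology_inverse')
qed

lemma topspace_base_topology [simp]: "topspace base_topology = carrier G"
proof
  show "topspace base_topology \<subseteq> carrier G"
    unfolding topspace_def openin_base_topology by blast
  have "openin base_topology (carrier G)"
    unfolding openin_base_topology l_coset_def using U_subset by blast
  then show "carrier G \<subseteq> topspace base_topology"
    by (rule openin_subset)
qed

text \<open>
  The members of the base need not be open, so translates of them are neighbourhoods only through
  their interiors.
\<close>

lemma interior_of_translate:
  assumes x: "x \<in> carrier G" and V: "V \<subseteq> carrier G" and iV: "x <# U i \<subseteq> V"
  obtains W where "openin base_topology W" and "x \<in> W" and "W \<subseteq> V"
proof -
  define W where "W = {y \<in> carrier G. \<exists>j. y <# U j \<subseteq> V}"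
  have "\<exists>j. y <# U j \<subseteq> W" if "y \<in> W" for y
  proof -
    obtain j where y: "y \<in> carrier G" and j: "y <# U j \<subseteq> V"
      using \<open>y \<in> W\<close> by (auto simp: W_def)
    obtain k where k: "U k <#> U k \<subseteq> U j"
      using U_mult by blast
    have "y \<otimes> u \<in> W" if u: "u \<in> U k" for u
    proof -
      have "y \<otimes> u \<otimes> v \<in> V" if v: "v \<in> U k" for v
      proof -
        have "u \<otimes> v \<in> U j"
          using k u v unfolding set_mult_def by blast
        moreover have "y \<otimes> u \<otimes> v = y \<otimes> (u \<otimes> v)"
          using y u v in_U_carrier by (simp add: m_assoc)
        ultimately show ?thesis
          using j unfolding l_coset_def by force
      qed
      then show ?thesis
        using y u in_U_carrier unfolding W_def l_coset_def by blast
    qed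
    then show ?thesis
      unfolding l_coset_def by blast
  qed
  then have "openin base_topology W"
    unfolding openin_base_topology by (auto simp: W_def)
  moreover have "x \<in> W"
    using x iV by (auto simp: W_def)
  moreover have "W \<subseteq> V"
  proof
    fix y assume "y \<in> W"
    then obtain j where "y \<in> carrier G" "y <# U j \<subseteq> V"
      by (auto simp: W_def)
    then have "y \<otimes> \<one> \<in> V"
      using one_in_U unfolding l_coset_def by blast
    then show "y \<in> V"
      using \<open>y \<in> carrier G\<close> by simp
  qed
  ultimately show thesis
    using that by blast
qed

lemma openin_base_topologyD:
  assumes "openin base_topology W" and "x \<in> W"
  obtains i where "\<And>u. u \<in> U i \<Longrightarrow> x \<otimes> u \<in> W"
proof -
  obtain i where "x <# U i \<subseteq> W"
    using assms by (auto simp: openin_base_topology)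
  then show thesis
    using that[of i] unfolding l_coset_def by blast
qed

lemma open_translate:
  assumes "x \<in> carrier G"
  obtains W where "openin base_topology W" and "x \<in> W" and "\<And>y. y \<in> W \<Longrightarrow> \<exists>u\<in>U i. y = x \<otimes> u"
proof -
  have "x <# U i \<subseteq> carrier G"
    using assms U_subset by (simp add: l_coset_subset_G)
  then obtain W where "openin base_topology W" "x \<in> W" "W \<subseteq> x <# U i"
    using interior_of_translate[OF assms _ order_refl] by blast
  then show thesis
    using that unfolding l_coset_def by blast
qed

lemma eventually_nhdsin_base_topology:
  assumes x: "x \<in> carrier G"
  shows "eventually P (nhdsin base_topology x) \<longleftrightarrow> (\<exists>i. \<forall>u\<in>U i. P (x \<otimes> u))"
proof
  assume "eventually P (nhdsin base_topology x)"
  then obtain W where "openin base_topology W" "x \<in> W" "\<forall>y\<in>W. P y"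
    using x by (auto simp: eventually_nhdsin)
  then show "\<exists>i. \<forall>u\<in>U i. P (x \<otimes> u)"
    by (metis openin_base_topologyD)
next
  assume "\<exists>i. \<forall>u\<in>U i. P (x \<otimes> u)"
  then obtain i where i: "\<And>u. u \<in> U i \<Longrightarrow> P (x \<otimes> u)"
    by blast
  obtain W where "openin base_topology W" "x \<in> W" "\<And>y. y \<in> W \<Longrightarrow> \<exists>u\<in>U i. y = x \<otimes> u"
    using open_translate[OF x] by blast
  then show "eventually P (nhdsin base_topology x)"
    using x i by (auto simp: eventually_nhdsin)
qed

lemma group_topology_base_topology: "group_topology G base_topology"
  unfolding group_topology_def
proof (intro conjI)
  have "openin (prod_topology base_topology base_topology)
      {z \<in> topspace (prod_topology base_topology base_topology). (case z of (x, y) \<Rightarrow> x \<otimes> y) \<in> W}"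
    (is "openin _ ?S") if W: "openin base_topology W" for W
    unfolding openin_prod_topology_alt
  proof (intro allI impI)
    fix x y assume "(x, y) \<in> ?S"
    then have xy: "x \<in> carrier G" "y \<in> carrier G" and xyW: "x \<otimes> y \<in> W"
      by auto
    obtain i where i: "\<And>u. u \<in> U i \<Longrightarrow> x \<otimes> y \<otimes> u \<in> W"
      using openin_base_topologyD[OF W xyW] by blast
    obtain j where j: "U j <#> U j \<subseteq> U i"
      using U_mult by blast
    obtain X where X: "openin base_topology X" "x \<in> X" "\<And>z. z \<in> X \<Longrightarrow> \<exists>u\<in>U j. z = x \<otimes> u"
      using open_translate[OF xy(1)] by blast
    obtain Y where Y: "openin base_topology Y" "y \<in> Y" "\<And>z. z \<in> Y \<Longrightarrow> \<exists>u\<in>U j. z = y \<otimes> u"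
      using open_translate[OF xy(2)] by blast
    have "a \<otimes> b \<in> W" if "a \<in> X" "b \<in> Y" for a b
    proof -
      obtain u v where uv: "u \<in> U j" "v \<in> U j" "a = x \<otimes> u" "b = y \<otimes> v"
        using X(3) Y(3) \<open>a \<in> X\<close> \<open>b \<in> Y\<close> by blast
      then have "u \<otimes> v \<in> U i"
        using j unfolding set_mult_def by blast
      moreover have "a \<otimes> b = x \<otimes> y \<otimes> (u \<otimes> v)"
        using xy uv in_U_carrier by (simp add: m_ac)
      ultimately show ?thesis
        using i by simp
    qed
    then have "X \<times> Y \<subseteq> ?S"
      using openin_subset[OF X(1)] openin_subset[OF Y(1)] by auto
    then show "\<exists>X Y. openin base_topology X \<and> openin base_topology Y \<and> x \<in> X \<and> y \<in> Y \<and> X \<times> Y \<subseteq> ?S"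
      using X Y by blast
  qed
  then show "continuous_map (prod_topology base_topology base_topology) base_topology (\<lambda>(x, y). x \<otimes> y)"
    by (auto simp: continuous_map_def)
  have "openin base_topology {x \<in> carrier G. inv x \<in> W}" if W: "openin base_topology W" for W
    unfolding openin_base_topology
  proof (intro conjI ballI)
    fix x assume "x \<in> {x \<in> carrier G. inv x \<in> W}"
    then have x: "x \<in> carrier G" "inv x \<in> W"
      by auto
    obtain i where i: "\<And>u. u \<in> U i \<Longrightarrow> inv x \<otimes> u \<in> W"
      using openin_base_topologyD[OF W x(2)] by blast
    have "inv (x \<otimes> u) \<in> W" if "u \<in> U i" for u
      using i[OF inv_in_U[OF that]] x that in_U_carrier by (simp add: inv_mult)
    then show "\<exists>i. x <# U i \<subseteq> {x \<in> carrier G. inv x \<in> W}"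
      using x in_U_carrier unfolding l_coset_def by blast
  qed auto
  then show "continuous_map base_topology base_topology (\<lambda>x. inv x)"
    by (auto simp: continuous_map_def)
qed simp

lemma Hausdorff_space_base_topology:
  assumes sep: "\<And>x. x \<in> carrier G \<Longrightarrow> x \<noteq> \<one> \<Longrightarrow> \<exists>i. x \<notin> U i"
  shows "Hausdorff_space base_topology"
  unfolding Hausdorff_space_def topspace_base_topology
proof (intro allI impI, elim conjE)
  fix x y assume xy: "x \<in> carrier G" "y \<in> carrier G" "x \<noteq> y"
  then have "x \<otimes> inv y \<noteq> \<one>"
    using inv_equality by (metis inv_closed inv_inv)
  then obtain i where i: "x \<otimes> inv y \<notin> U i"
    using sep[of "x \<otimes> inv y"] xy by auto
  obtain j where j: "U j <#> U j \<subseteq> U i"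
    using U_mult by blast
  obtain X where X: "openin base_topology X" "x \<in> X" "\<And>z. z \<in> X \<Longrightarrow> \<exists>u\<in>U j. z = x \<otimes> u"
    using open_translate[OF xy(1)] by blast
  obtain Y where Y: "openin base_topology Y" "y \<in> Y" "\<And>z. z \<in> Y \<Longrightarrow> \<exists>u\<in>U j. z = y \<otimes> u"
    using open_translate[OF xy(2)] by blast
  have False if "z \<in> X" "z \<in> Y" for z
  proof -
    obtain u v where uv: "u \<in> U j" "v \<in> U j" "z = x \<otimes> u" "z = y \<otimes> v"
      using X(3) Y(3) \<open>z \<in> X\<close> \<open>z \<in> Y\<close> by blast
    then have c: "u \<in> carrier G" "v \<in> carrier G" and eq: "x \<otimes> u = y \<otimes> v"
      using in_U_carrier by auto
    have "x = y \<otimes> v \<otimes> inv u"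
      using xy c eq by (simp add: inv_solve_right)
    also have "\<dots> = v \<otimes> inv u \<otimes> y"
      using xy c by (simp add: m_ac)
    finally have "x \<otimes> inv y = v \<otimes> inv u"
      using xy c by (simp add: inv_solve_right')
    moreover have "v \<otimes> inv u \<in> U i"
      using j uv inv_in_U unfolding set_mult_def by blast
    ultimately show False
      using i by simp
  qed
  then show "\<exists>X Y. openin base_topology X \<and> openin base_topology Y \<and> x \<in> X \<and> y \<in> Y \<and> disjnt X Y"
    using X Y unfolding disjnt_iff by blast
qed

end

section \<open>The group topology of a shrinking sequence of sets\<close>

text \<open>
  The sets \<open>A n\<close> play the role of the tails \<open>{x\<^sub>k, inv x\<^sub>k, \<one> | k \<ge> n}\<close> of a sequence that is meant to
  converge to \<open>\<one>\<close>. Finiteness of \<open>A 0 - A n\<close> makes \<open>A 0\<close> compact in any topology in which the \<open>A n\<close>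
  shrink to \<open>\<one>\<close>.
\<close>

locale shrinking_sets = comm_group G for G (structure) +
  fixes A :: "nat \<Rightarrow> 'a set"
  assumes A_subset: "A n \<subseteq> carrier G"
    and one_in_A: "\<one> \<in> A n"
    and inv_in_A: "x \<in> A n \<Longrightarrow> inv x \<in> A n"
    and A_antimono: "m \<le> n \<Longrightarrow> A n \<subseteq> A m"
    and finite_A_diff: "finite (A 0 - A n)"
begin

primrec prods :: "(nat \<Rightarrow> nat) \<Rightarrow> nat \<Rightarrow> 'a set" where
  "prods s 0 = {\<one>}"
| "prods s (Suc k) = prods s k <#> A (s k)"

text \<open>
  Basic neighbourhoods of \<open>\<one>\<close> in the finest group topology for which every neighbourhood of \<open>\<one>\<close>
  contains some \<open>A n\<close>.
\<close>

definition nbhd :: "(nat \<Rightarrow> nat) \<Rightarrow> 'a set" where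
  "nbhd s = (\<Union>k. prods s k)"

lemma in_A_carrier: "a \<in> A n \<Longrightarrow> a \<in> carrier G"
  using A_subset by blast

lemma prods_SucI: "x \<in> prods s k \<Longrightarrow> a \<in> A (s k) \<Longrightarrow> x \<otimes> a \<in> prods s (Suc k)"
  by (auto simp: set_mult_def)

lemma prods_SucE:
  assumes "x \<in> prods s (Suc k)"
  obtains y a where "y \<in> prods s k" and "a \<in> A (s k)" and "x = y \<otimes> a"
  using assms by (auto simp: set_mult_def)

declare prods.simps(2) [simp del]

lemma in_prods_carrier: "x \<in> prods s k \<Longrightarrow> x \<in> carrier G"
  by (induction k arbitrary: x) (auto elim!: prods_SucE simp: in_A_carrier)

lemma prods_le_Suc: "prods s k \<subseteq> prods s (Suc k)"
proof
  fix x assume x: "x \<in> prods s k"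
  then have "x \<otimes> \<one> \<in> prods s (Suc k)"
    by (rule prods_SucI) (rule one_in_A)
  then show "x \<in> prods s (Suc k)"
    using in_prods_carrier[OF x] by simp
qed

lemma prods_mono: "k \<le> l \<Longrightarrow> prods s k \<subseteq> prods s l"
  using prods_le_Suc by (rule lift_Suc_mono_le)

lemma one_in_prods: "\<one> \<in> prods s k"
  using prods_mono[of 0 k s] by simp

lemma inv_in_prods: "x \<in> prods s k \<Longrightarrow> inv x \<in> prods s k"
proof (induction k arbitrary: x)
  case (Suc k)
  then obtain y a where ya: "y \<in> prods s k" "a \<in> A (s k)" "x = y \<otimes> a"
    by (elim prods_SucE)
  then have "inv y \<otimes> inv a \<in> prods s (Suc k)"
    using Suc.IH inv_in_A by (intro prods_SucI) auto
  then show ?case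
    using ya in_prods_carrier in_A_carrier by (simp add: inv_mult)
qed simp

lemma prods_antimono: "(\<And>i. s i \<le> t i) \<Longrightarrow> prods t k \<subseteq> prods s k"
proof (induction k)
  case (Suc k)
  then show ?case
    using A_antimono[OF Suc.prems, of k] by (auto elim!: prods_SucE intro!: prods_SucI)
qed simp

lemma prods_add:
  assumes "x \<in> prods s (i + j)"
  obtains y z where "y \<in> prods s i" and "z \<in> prods (\<lambda>n. s (i + n)) j" and "x = y \<otimes> z"
  using assms
proof (induction j arbitrary: x thesis)
  case 0
  then show ?case
    using in_prods_carrier by (intro 0(1)[of x \<one>]) auto
next
  case (Suc j)
  then obtain x' a where x': "x' \<in> prods s (i + j)" "a \<in> A (s (i + j))" "x = x' \<otimes> a"
    by (auto elim: prods_SucE)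
  obtain y z where yz: "y \<in> prods s i" "z \<in> prods (\<lambda>n. s (i + n)) j" "x' = y \<otimes> z"
    using Suc.IH x'(1) by blast
  have "z \<otimes> a \<in> prods (\<lambda>n. s (i + n)) (Suc j)"
    using yz x' by (intro prods_SucI)
  moreover have "x = y \<otimes> (z \<otimes> a)"
    using yz x' in_prods_carrier in_A_carrier by (simp add: m_assoc)
  ultimately show ?case
    using Suc.prems(1) yz(1) by blast
qed

lemma prods_mult_same:
  assumes "x \<in> prods (\<lambda>_. n) i" and "y \<in> prods (\<lambda>_. n) j"
  shows "x \<otimes> y \<in> prods (\<lambda>_. n) (i + j)"
  using assms(2)
proof (induction j arbitrary: y)
  case 0
  then show ?case
    using assms(1) in_prods_carrier by simp
next
  case (Suc j)
  then obtain z a where z: "z \<in> prods (\<lambda>_. n) j" "a \<in> A n" "y = z \<otimes> a"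
    by (elim prods_SucE)
  then have "(x \<otimes> z) \<otimes> a \<in> prods (\<lambda>_. n) (Suc (i + j))"
    using Suc.IH by (intro prods_SucI)
  then show ?case
    using z assms(1) in_prods_carrier in_A_carrier by (simp add: m_assoc)
qed

text \<open>
  Continuity of multiplication: two products are merged into one by alternating their factors,
  which is why the bound \<open>t i\<close> must dominate both \<open>s (2 i)\<close> and \<open>s (2 i + 1)\<close>.
\<close>

lemma prods_interleave:
  assumes t: "\<And>i. s (2 * i) \<le> t i" "\<And>i. s (Suc (2 * i)) \<le> t i"
    and "x \<in> prods t k" and "y \<in> prods t k"
  shows "x \<otimes> y \<in> prods s (2 * k)"
  using assms(3,4)
proof (induction k arbitrary: x y)
  case (Suc k)
  obtain x' a where x': "x' \<in> prods t k" "a \<in> A (t k)" "x = x' \<otimes> a"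
    using Suc.prems(1) by (rule prods_SucE)
  obtain y' b where y': "y' \<in> prods t k" "b \<in> A (t k)" "y = y' \<otimes> b"
    using Suc.prems(2) by (rule prods_SucE)
  have "x' \<otimes> y' \<otimes> a \<otimes> b \<in> prods s (Suc (Suc (2 * k)))"
    using Suc.IH[OF x'(1) y'(1)] A_antimono t x' y' by (intro prods_SucI) blast+
  moreover have "x \<otimes> y = x' \<otimes> y' \<otimes> a \<otimes> b"
    using x' y' in_prods_carrier in_A_carrier by (simp add: m_ac)
  ultimately show ?case
    by simp
qed simp

lemma in_nbhd_carrier: "x \<in> nbhd s \<Longrightarrow> x \<in> carrier G"
  by (auto simp: nbhd_def in_prods_carrier)

lemma nbhd_antimono: "(\<And>i. s i \<le> t i) \<Longrightarrow> nbhd t \<subseteq> nbhd s"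
  using prods_antimono unfolding nbhd_def by blast

lemma A_subset_nbhd: "A (s 0) \<subseteq> nbhd s"
proof
  fix a assume a: "a \<in> A (s 0)"
  then have "\<one> \<otimes> a \<in> prods s (Suc 0)"
    by (intro prods_SucI) simp_all
  then show "a \<in> nbhd s"
    using in_A_carrier[OF a] unfolding nbhd_def by auto
qed

sublocale group_nbhd_base G nbhd
proof unfold_locales
  show "nbhd s \<subseteq> carrier G" for s
    by (auto simp: in_nbhd_carrier)
  show "\<one> \<in> nbhd s" for s
    by (auto simp: nbhd_def one_in_prods)
  show "inv x \<in> nbhd s" if "x \<in> nbhd s" for x s
    using that inv_in_prods unfolding nbhd_def by blast
  show "\<exists>r. nbhd r \<subseteq> nbhd s \<inter> nbhd t" for s t
    using nbhd_antimono[of s "\<lambda>i. max (s i) (t i)"] nbhd_antimono[of t "\<lambda>i. max (s i) (t i)"]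
    by (intro exI[of _ "\<lambda>i. max (s i) (t i)"]) simp
  show "\<exists>t. nbhd t <#> nbhd t \<subseteq> nbhd s" for s
  proof (intro exI subsetI)
    let ?t = "\<lambda>i. max (s (2 * i)) (s (Suc (2 * i)))"
    fix z assume "z \<in> nbhd ?t <#> nbhd ?t"
    then obtain x y k l where xy: "x \<in> prods ?t k" "y \<in> prods ?t l" and z: "z = x \<otimes> y"
      by (auto simp: set_mult_def nbhd_def)
    have "x \<in> prods ?t (max k l)" "y \<in> prods ?t (max k l)"
      using xy prods_mono[of k "max k l" ?t] prods_mono[of l "max k l" ?t] by auto
    then have "z \<in> prods s (2 * max k l)"
      unfolding z by (rule prods_interleave[rotated 2]) simp_all
    then show "z \<in> nbhd s"
      by (auto simp: nbhd_def)
  qed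
qed

text \<open>
  The negation says that the filter comes arbitrarily close to \<open>K\<close>: each uniform neighbourhood
  \<open>M <#> nbhd s\<close> of a set \<open>M\<close> in the filter meets \<open>K\<close>.
\<close>

definition far_from :: "'a filter \<Rightarrow> 'a set \<Rightarrow> bool" where
  "far_from F K \<longleftrightarrow> (\<exists>M s. (\<forall>\<^sub>F x in F. x \<in> M) \<and> (\<forall>x\<in>M. \<forall>u\<in>nbhd s. x \<otimes> u \<notin> K))"

lemma far_from_finite_Union:
  assumes "finite I" and "\<And>i. i \<in> I \<Longrightarrow> far_from F (K i)"
  shows "far_from F (\<Union>i\<in>I. K i)"
  using assms
proof (induction I rule: finite_induct)
  case empty
  then show ?case
    unfolding far_from_def by (intro exI[of _ UNIV]) simp
next
  case (insert i I)
  then have "far_from F (K i)" "far_from F (\<Union>i\<in>I. K i)"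
    by auto
  then obtain M s M' s' where M: "\<forall>\<^sub>F x in F. x \<in> M" "\<And>x u. x \<in> M \<Longrightarrow> u \<in> nbhd s \<Longrightarrow> x \<otimes> u \<notin> K i"
    and M': "\<forall>\<^sub>F x in F. x \<in> M'" "\<And>x u. x \<in> M' \<Longrightarrow> u \<in> nbhd s' \<Longrightarrow> x \<otimes> u \<notin> (\<Union>i\<in>I. K i)"
    unfolding far_from_def by metis
  obtain r where "nbhd r \<subseteq> nbhd s \<inter> nbhd s'"
    using U_inter by blast
  then have "\<forall>x\<in>M \<inter> M'. \<forall>u\<in>nbhd r. x \<otimes> u \<notin> (\<Union>i\<in>insert i I. K i)"
    using M(2) M'(2) by blast
  moreover have "\<forall>\<^sub>F x in F. x \<in> M \<inter> M'"
    using M(1) M'(1) by eventually_elim simp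
  ultimately show ?case
    unfolding far_from_def by blast
qed

lemma far_from_subset: "far_from F K \<Longrightarrow> L \<subseteq> K \<Longrightarrow> far_from F L"
  unfolding far_from_def by blast

text \<open>
  A stand-in for compactness of \<open>A 0\<close>. Being far from \<open>y <# K\<close> gives the same for
  \<open>(y \<otimes> a) <# K\<close> simultaneously for all \<open>a\<close> in a small set \<open>A (t 0)\<close>, by passing to a smaller
  neighbourhood; only finitely many \<open>a \<in> A 0\<close> remain.
\<close>

lemma far_from_Suc:
  assumes F: "F \<le> principal (carrier G)" and y: "y \<in> carrier G"
    and far: "\<And>a. a \<in> A 0 \<Longrightarrow> far_from F ((y \<otimes> a) <# prods (\<lambda>_. 0) n)"
  shows "far_from F (y <# prods (\<lambda>_. 0) (Suc n))"
proof -
  let ?K = "prods (\<lambda>_. 0) n"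
  have "far_from F (y <# ?K)"
    using far[OF one_in_A] y by simp
  then obtain M s where M: "\<forall>\<^sub>F x in F. x \<in> M" "\<And>x u. x \<in> M \<Longrightarrow> u \<in> nbhd s \<Longrightarrow> x \<otimes> u \<notin> y <# ?K"
    unfolding far_from_def by blast
  obtain t where t: "nbhd t <#> nbhd t \<subseteq> nbhd s"
    using U_mult by blast
  have "far_from F (\<Union>a\<in>A (t 0). (y \<otimes> a) <# ?K)"
    unfolding far_from_def
  proof (intro exI conjI ballI)
    show "\<forall>\<^sub>F x in F. x \<in> M \<inter> carrier G"
      using M(1) F by (auto simp: le_principal eventually_conj_iff)
    fix x u assume x: "x \<in> M \<inter> carrier G" and u: "u \<in> nbhd t"
    show "x \<otimes> u \<notin> (\<Union>a\<in>A (t 0). (y \<otimes> a) <# ?K)"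
    proof
      assume "x \<otimes> u \<in> (\<Union>a\<in>A (t 0). (y \<otimes> a) <# ?K)"
      then obtain a k where a: "a \<in> A (t 0)" and k: "k \<in> ?K" and eq: "x \<otimes> u = y \<otimes> a \<otimes> k"
        by (auto simp: l_coset_def)
      have c: "x \<in> carrier G" "u \<in> carrier G" "a \<in> carrier G" "k \<in> carrier G"
        using x u a k in_nbhd_carrier in_A_carrier in_prods_carrier by auto
      have "inv a \<in> nbhd t"
        using a A_subset_nbhd inv_in_A by blast
      then have "u \<otimes> inv a \<in> nbhd s"
        using u t unfolding set_mult_def by blast
      then have "x \<otimes> (u \<otimes> inv a) \<notin> y <# ?K"
        using M(2) x by blast
      moreover have "x \<otimes> (u \<otimes> inv a) = y \<otimes> a \<otimes> k \<otimes> inv a"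
        using c by (simp add: m_assoc flip: eq)
      moreover have "y \<otimes> a \<otimes> k = y \<otimes> k \<otimes> a"
        using c y by (simp add: m_ac)
      ultimately have "y \<otimes> k \<notin> y <# ?K"
        using c y by (simp add: m_assoc)
      then show False
        using k by (auto simp: l_coset_def)
    qed
  qed
  moreover have "far_from F (\<Union>a\<in>A 0 - A (t 0). (y \<otimes> a) <# ?K)"
    using far by (intro far_from_finite_Union finite_A_diff) auto
  ultimately have "far_from F (\<Union>X\<in>{\<Union>a\<in>A (t 0). (y \<otimes> a) <# ?K, \<Union>a\<in>A 0 - A (t 0). (y \<otimes> a) <# ?K}. X)"
    by (intro far_from_finite_Union) auto
  then show ?thesis
  proof (rule far_from_subset, intro subsetI)
    fix z assume "z \<in> y <# prods (\<lambda>_. 0) (Suc n)"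
    then obtain k a where k: "k \<in> ?K" and a: "a \<in> A 0" and z: "z = y \<otimes> (k \<otimes> a)"
      by (auto simp: l_coset_def elim: prods_SucE)
    then have "z = y \<otimes> a \<otimes> k"
      using y in_prods_carrier in_A_carrier by (simp add: m_ac)
    then show "z \<in> (\<Union>X\<in>{\<Union>a\<in>A (t 0). (y \<otimes> a) <# ?K, \<Union>a\<in>A 0 - A (t 0). (y \<otimes> a) <# ?K}. X)"
      using k a by (auto simp: l_coset_def)
  qed
qed

lemma cauchy_filter_small_set:
  assumes F: "F \<le> principal (carrier G)" and cauchy: "group_cauchy_filter G base_topology F"
  obtains M where "\<forall>\<^sub>F x in F. x \<in> M" and "M \<subseteq> carrier G" and "\<And>x y. x \<in> M \<Longrightarrow> y \<in> M \<Longrightarrow> x \<otimes> inv y \<in> nbhd s"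
proof -
  have "eventually (\<lambda>z. z \<in> nbhd s) (nhdsin base_topology \<one>)"
    using in_nbhd_carrier by (auto simp: eventually_nhdsin_base_topology intro!: exI[of _ s])
  moreover have "eventually P (nhdsin base_topology \<one>) \<Longrightarrow> eventually (\<lambda>(x, y). P (x \<otimes> inv y)) (F \<times>\<^sub>F F)" for P
    using cauchy by (auto simp: group_cauchy_filter_def filterlim_iff case_prod_unfold)
  ultimately have "eventually (\<lambda>(x, y). x \<otimes> inv y \<in> nbhd s) (F \<times>\<^sub>F F)"
    by blast
  then obtain Q where Q: "eventually Q F" "\<And>x y. Q x \<Longrightarrow> Q y \<Longrightarrow> x \<otimes> inv y \<in> nbhd s"
    by (auto simp: eventually_prod_same)
  have "\<forall>\<^sub>F x in F. x \<in> {x \<in> carrier G. Q x}"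
    using Q(1) F by (auto simp: le_principal eventually_conj_iff)
  then show thesis
    using that[of "{x \<in> carrier G. Q x}"] Q(2) by auto
qed

text \<open>
  Suppose that \<open>F\<close> is far from all translates, as witnessed by the neighbourhoods given by \<open>\<sigma> n\<close> for products
  of length \<open>2 n\<close> translated by \<open>y0\<close>. The sequence \<open>s\<close> below is chosen so that for every \<open>m\<close> its
  shift by \<open>m\<close> dominates \<open>\<sigma> m\<close>. A member of \<open>F\<close> that is small with respect to \<open>nbhd s\<close> then lies in
  \<open>y <# nbhd s\<close>, where \<open>y\<close> differs from \<open>y0\<close> by some product of length \<open>m\<close>: the first \<open>m\<close> factors from
  \<open>nbhd s\<close> lengthen this product to \<open>2 m\<close>, and the others form an element of \<open>nbhd (\<sigma> m)\<close>. This
  contradicts farness for \<open>n = m\<close>. The length \<open>2 n\<close> leaves room because \<open>m\<close> is known only after \<open>s\<close> has been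
  fixed.
\<close>

lemma cauchy_filter_not_far_from_prods:
  assumes F: "F \<le> principal (carrier G)" "F \<noteq> bot" and cauchy: "group_cauchy_filter G base_topology F"
  obtains y n where "y \<in> carrier G" and "\<not> far_from F (y <# prods (\<lambda>_. 0) n)"
proof (rule ccontr)
  assume "\<not> thesis"
  then have far: "far_from F (y <# prods (\<lambda>_. 0) n)" if "y \<in> carrier G" for y n
    using \<open>y \<in> carrier G\<close> \<open>\<And>y n. \<lbrakk>y \<in> carrier G; \<not> far_from F (y <# prods (\<lambda>_. 0) n)\<rbrakk> \<Longrightarrow> thesis\<close> by blast
  obtain M0 where M0: "\<forall>\<^sub>F x in F. x \<in> M0" "M0 \<subseteq> carrier G"
    "\<And>x y. x \<in> M0 \<Longrightarrow> y \<in> M0 \<Longrightarrow> x \<otimes> inv y \<in> nbhd (\<lambda>_. 0)"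
    using cauchy_filter_small_set[OF F(1) cauchy] by blast
  obtain y0 where y0: "y0 \<in> M0" "y0 \<in> carrier G"
    using eventually_happens[OF M0(1)] F(2) M0(2) by auto
  have "\<exists>M s. (\<forall>\<^sub>F x in F. x \<in> M) \<and> (\<forall>x\<in>M. \<forall>u\<in>nbhd s. x \<otimes> u \<notin> y0 <# prods (\<lambda>_. 0) (2 * n))" for n
    using far[OF y0(2)] unfolding far_from_def .
  then obtain M \<sigma> where M: "\<And>n. \<forall>\<^sub>F x in F. x \<in> M n"
    and \<sigma>: "\<And>n x u. x \<in> M n \<Longrightarrow> u \<in> nbhd (\<sigma> n) \<Longrightarrow> x \<otimes> u \<notin> y0 <# prods (\<lambda>_. 0) (2 * n)"
    by metis
  \<comment> \<open>The sum is merely a convenient upper bound of the finitely many values \<open>\<sigma> i (k - i)\<close>.\<close>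
  define s where "s k = (\<Sum>i\<le>k. \<sigma> i (k - i))" for k
  have s: "\<sigma> i j \<le> s (i + j)" for i j
    unfolding s_def using member_le_sum[of i "{..i + j}" "\<lambda>l. \<sigma> l (i + j - l)"] by simp
  obtain N where N: "\<forall>\<^sub>F x in F. x \<in> N" "N \<subseteq> carrier G" "\<And>x y. x \<in> N \<Longrightarrow> y \<in> N \<Longrightarrow> x \<otimes> inv y \<in> nbhd s"
    using cauchy_filter_small_set[OF F(1) cauchy] by blast
  have "\<forall>\<^sub>F x in F. x \<in> N \<and> x \<in> M0"
    using N(1) M0(1) by eventually_elim simp
  then obtain y where y: "y \<in> N" "y \<in> M0" "y \<in> carrier G"
    using eventually_happens[of _ F] F(2) N(2) by blast
  then obtain m where m: "y \<otimes> inv y0 \<in> prods (\<lambda>_. 0) m"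
    using M0(3) y0 unfolding nbhd_def by blast
  have "\<forall>\<^sub>F x in F. x \<in> N \<and> x \<in> M m"
    using N(1) M[of m] by eventually_elim simp
  then obtain z where z: "z \<in> N" "z \<in> M m" "z \<in> carrier G"
    using eventually_happens[of _ F] F(2) N(2) by blast
  then obtain k where "z \<otimes> inv y \<in> prods s k"
    using N(3) y unfolding nbhd_def by blast
  then have "z \<otimes> inv y \<in> prods s (m + k)"
    using prods_mono[of k "m + k" s] by auto
  then obtain a b where a: "a \<in> prods s m" and b: "b \<in> prods (\<lambda>n. s (m + n)) k" and zab: "z \<otimes> inv y = a \<otimes> b"
    by (rule prods_add)
  have "b \<in> prods (\<sigma> m) k"
    using b prods_antimono[of "\<sigma> m" "\<lambda>n. s (m + n)" k] s by blast
  then have "inv b \<in> nbhd (\<sigma> m)"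
    using inv_in_prods unfolding nbhd_def by blast
  then have notin: "z \<otimes> inv b \<notin> y0 <# prods (\<lambda>_. 0) (2 * m)"
    using \<sigma> z by blast
  have "a \<in> prods (\<lambda>_. 0) m"
    using a prods_antimono[of "\<lambda>_. 0" s m] by auto
  then have "y \<otimes> inv y0 \<otimes> a \<in> prods (\<lambda>_. 0) (m + m)"
    using m by (intro prods_mult_same)
  then have "y0 \<otimes> (y \<otimes> inv y0 \<otimes> a) \<in> y0 <# prods (\<lambda>_. 0) (2 * m)"
    by (auto simp: l_coset_def mult_2)
  moreover have "y0 \<otimes> (y \<otimes> inv y0 \<otimes> a) = z \<otimes> inv b"
  proof -
    have c: "a \<in> carrier G" "b \<in> carrier G"
      using a b in_prods_carrier by auto
    define w where "w = y \<otimes> inv y0"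
    have w: "w \<in> carrier G" and yw: "w \<otimes> y0 = y"
      using y y0 by (simp_all add: w_def m_assoc)
    then have "y0 \<otimes> (w \<otimes> a) = a \<otimes> y"
      using y0 c by (simp add: m_ac flip: yw)
    then have "y0 \<otimes> (y \<otimes> inv y0 \<otimes> a) = a \<otimes> y"
      by (simp add: w_def)
    also have "\<dots> = z \<otimes> inv b"
    proof -
      have "z = a \<otimes> b \<otimes> y"
        using zab y z c by (simp add: inv_solve_right')
      also have "\<dots> = a \<otimes> y \<otimes> b"
        using c y by (simp add: m_ac)
      finally show ?thesis
        using c y z by (simp add: inv_solve_right)
    qed
    finally show ?thesis .
  qed
  ultimately show False
    using notin by simp
qed

text \<open>
  Peel off the factors one at a time with \<open>far_from_Suc\<close>.
\<close>

lemma not_far_from_prods_imp_not_far_from_point: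
  assumes F: "F \<le> principal (carrier G)" and y: "y \<in> carrier G"
    and far: "\<not> far_from F (y <# prods (\<lambda>_. 0) n)"
  obtains x where "x \<in> carrier G" and "\<not> far_from F {x}"
proof -
  have "\<exists>x\<in>carrier G. \<not> far_from F {x}"
    using y far
  proof (induction n arbitrary: y)
    case 0
    then have "y <# prods (\<lambda>_. 0) 0 = {y}"
      by (simp add: l_coset_def)
    then show ?case
      using 0 by auto
  next
    case (Suc n)
    then obtain a where "a \<in> A 0" "\<not> far_from F ((y \<otimes> a) <# prods (\<lambda>_. 0) n)"
      using far_from_Suc[OF F Suc.prems(1)] by blast
    then show ?case
      using Suc.IH[of "y \<otimes> a"] Suc.prems(1) in_A_carrier by blast
  qed
  then show thesis
    using that by blast
qed

lemma cauchy_filter_converges: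
  assumes F: "F \<le> principal (carrier G)" and cauchy: "group_cauchy_filter G base_topology F"
    and x: "x \<in> carrier G" and near: "\<not> far_from F {x}"
  shows "F \<le> nhdsin base_topology x"
proof (rule filter_leI)
  fix P assume "eventually P (nhdsin base_topology x)"
  then obtain s where s: "\<And>u. u \<in> nbhd s \<Longrightarrow> P (x \<otimes> u)"
    using x by (auto simp: eventually_nhdsin_base_topology)
  obtain t where t: "nbhd t <#> nbhd t \<subseteq> nbhd s"
    using U_mult by blast
  obtain M where M: "\<forall>\<^sub>F x in F. x \<in> M" "M \<subseteq> carrier G" "\<And>x y. x \<in> M \<Longrightarrow> y \<in> M \<Longrightarrow> x \<otimes> inv y \<in> nbhd t"
    using cauchy_filter_small_set[OF F cauchy] by blast
  obtain y u where y: "y \<in> M" and u: "u \<in> nbhd t" and yu: "y \<otimes> u = x"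
    using near M(1) unfolding far_from_def by blast
  have "P z" if z: "z \<in> M" for z
  proof -
    have c: "y \<in> carrier G" "z \<in> carrier G" "u \<in> carrier G"
      using y z u M(2) in_nbhd_carrier by auto
    have "(z \<otimes> inv y) \<otimes> inv u \<in> nbhd s"
      using t M(3)[OF z y] inv_in_U[OF u] unfolding set_mult_def by blast
    then have "P (x \<otimes> (z \<otimes> inv y \<otimes> inv u))"
      by (rule s)
    moreover have "z \<otimes> inv y \<otimes> inv u = z \<otimes> inv x"
      using c by (simp add: m_assoc inv_mult flip: yu)
    moreover have "x \<otimes> (z \<otimes> inv x) = z"
      using c x by (simp add: m_comm[of x] m_assoc)
    ultimately show ?thesis
      by simp
  qed
  then show "eventually P F"
    using M(1) by (auto elim: eventually_mono)
qed

theorem complete_base_topology: "complete_group_topology G base_topology"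
  unfolding complete_group_topology_def
proof (intro allI impI)
  fix F assume F: "F \<le> principal (carrier G)" "F \<noteq> bot" and cauchy: "group_cauchy_filter G base_topology F"
  obtain y n where "y \<in> carrier G" "\<not> far_from F (y <# prods (\<lambda>_. 0) n)"
    using cauchy_filter_not_far_from_prods[OF F cauchy] by blast
  then obtain x where "x \<in> carrier G" "\<not> far_from F {x}"
    using not_far_from_prods_imp_not_far_from_point[OF F(1)] by blast
  then show "\<exists>x\<in>carrier G. F \<le> nhdsin base_topology x"
    using cauchy_filter_converges[OF F(1) cauchy] by blast
qed

end

section \<open>Binary digits that few powers of two cannot cancel\<close>

text \<open>
  The \<open>n + 1\<close> binary digits of \<open>spread_sum n\<close> have positions between \<open>n ^ 3\<close> and \<open>(n + 1) ^ 3\<close>,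
  each in the middle of a window of length \<open>2 * n\<close>. Consecutive cubes are far enough
  apart for this, so different \<open>n\<close> use separate ranges of digits.
\<close>

definition spread_sum :: "nat \<Rightarrow> nat" where
  "spread_sum n = (\<Sum>i\<le>n. 2 ^ (n ^ 3 + (2 * i + 1) * n))"

lemma sum_spread_powers_le:
  assumes "n > 0"
  shows "(\<Sum>i<k. 2 ^ (a + (2 * i + 1) * n)) \<le> (2::nat) ^ (a + 2 * k * n)"
proof (induction k)
  case (Suc k)
  have "(\<Sum>i<Suc k. 2 ^ (a + (2 * i + 1) * n)) \<le> (2::nat) ^ (a + 2 * k * n) * (1 + 2 ^ n)"
    using Suc by (simp add: algebra_simps power_add)
  also have "(1::nat) + 2 ^ n \<le> 2 ^ n * 2 ^ n"
  proof -
    obtain m where "n = Suc m"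
      using assms not0_implies_Suc by blast
    then have "(2::nat) \<le> 2 ^ n"
      by simp
    then have "2 * 2 ^ n \<le> 2 ^ n * (2::nat) ^ n"
      by (rule mult_right_mono) simp
    then show ?thesis
      using \<open>2 \<le> 2 ^ n\<close> by linarith
  qed
  finally have "(\<Sum>i<Suc k. 2 ^ (a + (2 * i + 1) * n)) \<le> (2::nat) ^ (a + 2 * k * n) * (2 ^ n * 2 ^ n)"
    by simp
  also have "\<dots> = 2 ^ (a + 2 * Suc k * n)"
    by (simp add: mult_2 distrib_right flip: power_add)
  finally show ?case .
qed simp

lemma spread_sum_le: "spread_sum n \<le> 2 ^ ((n + 1) ^ 3)"
proof (cases "n = 0")
  case True
  then show ?thesis
    by (simp add: spread_sum_def)
next
  case False
  have "spread_sum n \<le> 2 ^ (n ^ 3 + 2 * Suc n * n)"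
    using sum_spread_powers_le[of n "n ^ 3" "Suc n"] False by (simp add: spread_sum_def lessThan_Suc_atMost)
  also have "\<dots> \<le> 2 ^ ((n + 1) ^ 3)"
    by (intro power_increasing) (simp_all add: power3_eq_cube algebra_simps)
  finally show ?thesis .
qed

lemma power_dvd_spread_sum: "m \<le> n \<Longrightarrow> 2 ^ m dvd spread_sum n"
  unfolding spread_sum_def by (intro dvd_sum le_imp_power_dvd) (simp add: trans_le_add2)

text \<open>
  Pigeonhole for consecutive windows \<open>{p i..<p (Suc i)}\<close>: a nonzero integer in each
  contributes at least \<open>1\<close>.
\<close>

lemma nonzero_sum_ge:
  fixes b :: "nat \<Rightarrow> int" and p :: "nat \<Rightarrow> nat"
  assumes "mono p" and "\<And>i. i < k \<Longrightarrow> \<exists>m\<in>{p i..<p (Suc i)}. b m \<noteq> 0"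
  shows "(\<Sum>m\<in>{p 0..<p k}. \<bar>b m\<bar>) \<ge> int k"
  using assms(2)
proof (induction k)
  case (Suc k)
  have "p 0 \<le> p k" "p k \<le> p (Suc k)"
    using assms(1) by (auto simp: mono_def)
  then have "(\<Sum>m\<in>{p 0..<p (Suc k)}. \<bar>b m\<bar>) = (\<Sum>m\<in>{p 0..<p k}. \<bar>b m\<bar>) + (\<Sum>m\<in>{p k..<p (Suc k)}. \<bar>b m\<bar>)"
    by (simp add: sum.atLeastLessThan_concat)
  moreover obtain m where m: "m \<in> {p k..<p (Suc k)}" "b m \<noteq> 0"
    using Suc.prems[of k] by blast
  then have "\<bar>b m\<bar> \<le> (\<Sum>m\<in>{p k..<p (Suc k)}. \<bar>b m\<bar>)"
    by (intro member_le_sum) auto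
  moreover have "int k \<le> (\<Sum>m\<in>{p 0..<p k}. \<bar>b m\<bar>)"
    using Suc by simp
  ultimately show ?case
    using m(2) by simp
qed simp

lemma abs_sum_mult_le:
  fixes b f :: "nat \<Rightarrow> int"
  assumes "\<And>m. m \<in> A \<Longrightarrow> \<bar>f m\<bar> \<le> M"
  shows "\<bar>\<Sum>m\<in>A. b m * f m\<bar> \<le> (\<Sum>m\<in>A. \<bar>b m\<bar>) * M"
proof -
  have "\<bar>\<Sum>m\<in>A. b m * f m\<bar> \<le> (\<Sum>m\<in>A. \<bar>b m * f m\<bar>)"
    by (rule sum_abs)
  also have "\<dots> \<le> (\<Sum>m\<in>A. \<bar>b m\<bar> * M)"
    using assms by (intro sum_mono) (simp add: abs_mult mult_left_mono)
  finally show ?thesis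
    by (simp add: sum_distrib_right)
qed

text \<open>
  Let \<open>N\<close> be the largest index with \<open>c N \<noteq> 0\<close>. By sparsity one of the \<open>N + 1\<close> windows of
  \<open>spread_sum N\<close> contains no exponent \<open>m\<close> with \<open>b m \<noteq> 0\<close>. Reduce the relation modulo the power of two at the upper end of
  this window. What is left is \<open>c N\<close> times the digit in the middle of the window, plus terms from
  below the window. Their total multiplicity is at most \<open>N < 2 ^ N\<close>, so that half a window, of
  length \<open>N\<close>, keeps their sum below that digit. The whole is smaller than the modulus, hence zero, and yet the middle
  digit is larger than the rest.
\<close>

lemma sparse_relation_trivial:
  fixes b c :: "nat \<Rightarrow> int"
  assumes zero: "(\<Sum>m<B. b m * 2 ^ m) + (\<Sum>n<B. c n * int (spread_sum n)) = 0"
    and supp: "\<And>m. m \<ge> B \<Longrightarrow> b m = 0 \<and> c m = 0"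
    and sparse: "\<And>N. (\<Sum>m<(N + 1) ^ 3. \<bar>b m\<bar>) + (\<Sum>n<(N + 1) ^ 3. \<bar>c n\<bar>) \<le> int N"
  shows "c n = 0"
proof (rule ccontr)
  assume cn: "c n \<noteq> 0"
  define N where "N = Max {n. c n \<noteq> 0}"
  have "{n. c n \<noteq> 0} \<subseteq> {..<B}"
    using supp not_less by auto
  then have fin: "finite {n. c n \<noteq> 0}"
    using finite_subset by blast
  have cN: "c N \<noteq> 0"
    using Max_in[OF fin] cn by (auto simp: N_def)
  have above: "c k = 0" if "k > N" for k
    using Max_ge[OF fin, of k] that by (auto simp: N_def)
  define p where "p i = N ^ 3 + 2 * i * N" for i
  define M where "M = (N + 1) ^ 3"
  have pM: "p (Suc N) \<le> M" and NM: "N < M"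
    by (simp_all add: p_def M_def power3_eq_cube algebra_simps)
  have mono_p: "mono p"
    by (auto simp: mono_def p_def)
  \<comment> \<open>There are \<open>N + 1\<close> windows, but the total weight of \<open>b\<close> on them is at most \<open>N\<close>.\<close>
  have "\<exists>i\<le>N. \<forall>m\<in>{p i..<p (Suc i)}. b m = 0"
  proof (rule ccontr)
    assume "\<not> ?thesis"
    then have "int (Suc N) \<le> (\<Sum>m\<in>{p 0..<p (Suc N)}. \<bar>b m\<bar>)"
      by (intro nonzero_sum_ge mono_p) (auto simp: less_Suc_eq_le)
    also have "\<dots> \<le> (\<Sum>m<M. \<bar>b m\<bar>)"
      using pM by (intro sum_mono2) auto
    also have "\<dots> \<le> int N"
    proof -
      have "0 \<le> (\<Sum>n<M. \<bar>c n\<bar>)"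
        by (intro sum_nonneg) auto
      then show ?thesis
        using sparse[of N] unfolding M_def by linarith
    qed
    finally show False
      by simp
  qed
  then obtain i where i: "i \<le> N" and gap: "\<And>m. p i \<le> m \<Longrightarrow> m < p (Suc i) \<Longrightarrow> b m = 0"
    by auto
  define j where "j = p i + N"
  have q: "p (Suc i) = j + N"
    by (simp add: j_def p_def)
  define B' where "B' = max B M"
  have qM: "j + N \<le> B'"
    using pM mono_p i unfolding q[symmetric] B'_def mono_def by (meson Suc_le_mono le_max_iff_disj order_trans)
  have zero': "(\<Sum>m<B'. b m * 2 ^ m) + (\<Sum>n<B'. c n * int (spread_sum n)) = 0"
  proof -
    have "(\<Sum>m<B'. b m * 2 ^ m) = (\<Sum>m<B. b m * 2 ^ m)"
      by (rule sum.mono_neutral_right) (auto simp: B'_def supp)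
    moreover have "(\<Sum>n<B'. c n * int (spread_sum n)) = (\<Sum>n<B. c n * int (spread_sum n))"
      by (rule sum.mono_neutral_right) (auto simp: B'_def supp)
    ultimately show ?thesis
      using zero by simp
  qed
  define low_b where "low_b = (\<Sum>m<p i. b m * 2 ^ m)"
  define high_b where "high_b = (\<Sum>m\<in>{j + N..<B'}. b m * 2 ^ m)"
  define low_c where "low_c = (\<Sum>n<N. c n * int (spread_sum n))"
  define low_S where "low_S = (\<Sum>k<i. 2 ^ (N ^ 3 + (2 * k + 1) * N) :: nat)"
  define high_S where "high_S = (\<Sum>k\<in>{Suc i..<Suc N}. 2 ^ (N ^ 3 + (2 * k + 1) * N) :: nat)"
  have b_split: "(\<Sum>m<B'. b m * 2 ^ m) = low_b + high_b"
  proof -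
    have "p i \<le> j + N" 
      by (simp add: j_def)
    then have "(\<Sum>m<B'. b m * 2 ^ m) = low_b + (\<Sum>m\<in>{p i..<j + N}. b m * 2 ^ m) + high_b"
      using qM by (simp add: low_b_def high_b_def lessThan_atLeast0 sum.atLeastLessThan_concat add.assoc)
    also have "(\<Sum>m\<in>{p i..<j + N}. b m * 2 ^ m) = 0"
      using gap by (intro sum.neutral) (auto simp: q)
    finally show ?thesis
      by simp
  qed
  have c_split: "(\<Sum>n<B'. c n * int (spread_sum n)) = low_c + c N * int (spread_sum N)"
  proof -
    have "(\<Sum>n<B'. c n * int (spread_sum n)) = (\<Sum>n<Suc N. c n * int (spread_sum n))"
      using NM above by (intro sum.mono_neutral_right) (auto simp: B'_def)
    then show ?thesis
      by (simp add: low_c_def)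
  qed
  have S_split: "spread_sum N = low_S + 2 ^ j + high_S"
  proof -
    have "spread_sum N = (\<Sum>k\<in>{0..<Suc N}. 2 ^ (N ^ 3 + (2 * k + 1) * N))"
      by (simp only: spread_sum_def lessThan_Suc_atMost[symmetric] lessThan_atLeast0)
    also have "\<dots> = (\<Sum>k\<in>{0..<i}. 2 ^ (N ^ 3 + (2 * k + 1) * N)) + (\<Sum>k\<in>{i..<Suc N}. 2 ^ (N ^ 3 + (2 * k + 1) * N))"
      using i by (intro sum.atLeastLessThan_concat[symmetric]) auto
    also have "(\<Sum>k\<in>{i..<Suc N}. 2 ^ (N ^ 3 + (2 * k + 1) * N)) = 2 ^ (N ^ 3 + (2 * i + 1) * N) + high_S"
      unfolding high_S_def using i by (intro sum.atLeast_Suc_lessThan) auto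
    finally show ?thesis
      by (simp add: low_S_def lessThan_atLeast0 j_def p_def algebra_simps)
  qed
  define L where "L = low_b + low_c + c N * int low_S"
  have "(2::int) ^ (j + N) dvd high_b"
    unfolding high_b_def by (intro dvd_sum dvd_mult le_imp_power_dvd) auto
  moreover have "(2::nat) ^ (j + N) dvd high_S"
    unfolding high_S_def
  proof (intro dvd_sum le_imp_power_dvd)
    fix k assume "k \<in> {Suc i..<Suc N}"
    then have "(2 * Suc i) * N \<le> (2 * k + 1) * N"
      by (intro mult_right_mono) auto
    then show "j + N \<le> N ^ 3 + (2 * k + 1) * N"
      by (simp add: j_def p_def algebra_simps)
  qed
  then have "(2::int) ^ (j + N) dvd int high_S"
    by (metis of_nat_dvd_iff of_nat_numeral of_nat_power)
  ultimately have "(2::int) ^ (j + N) dvd - (high_b + c N * int high_S)"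
    by simp
  also have "- (high_b + c N * int high_S) = L + c N * 2 ^ j"
    using zero' unfolding b_split c_split S_split L_def by (simp add: algebra_simps)
  finally have dvd: "(2::int) ^ (j + N) dvd L + c N * 2 ^ j" .
  have count: "(\<Sum>m<p i. \<bar>b m\<bar>) + (\<Sum>n<N. \<bar>c n\<bar>) + \<bar>c N\<bar> \<le> int N"
  proof -
    have "p i \<le> M"
      using pM mono_p i by (meson le_Suc_eq monoD order_trans)
    then have "(\<Sum>m<p i. \<bar>b m\<bar>) \<le> (\<Sum>m<M. \<bar>b m\<bar>)"
      by (intro sum_mono2) auto
    moreover have "(\<Sum>n<Suc N. \<bar>c n\<bar>) \<le> (\<Sum>n<M. \<bar>c n\<bar>)"
      using NM by (intro sum_mono2) auto
    ultimately show ?thesis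
      using sparse[of N] by (simp add: M_def)
  qed
  have cN_le: "\<bar>c N\<bar> \<le> int N"
  proof -
    have "0 \<le> (\<Sum>m<p i. \<bar>b m\<bar>)" "0 \<le> (\<Sum>n<N. \<bar>c n\<bar>)"
      by (auto intro: sum_nonneg)
    then show ?thesis
      using count by linarith
  qed
  then have N: "N > 0"
    using cN by (cases "N = 0") auto
  have "\<bar>low_b\<bar> \<le> (\<Sum>m<p i. \<bar>b m\<bar>) * 2 ^ p i"
    unfolding low_b_def by (intro abs_sum_mult_le) (auto intro: power_increasing)
  moreover have "\<bar>low_c\<bar> \<le> (\<Sum>n<N. \<bar>c n\<bar>) * 2 ^ p i"
    unfolding low_c_def
  proof (intro abs_sum_mult_le)
    fix n assume "n \<in> {..<N}"
    then have "(n + 1) ^ 3 \<le> N ^ 3"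
      by (intro power_mono) auto
    then have "(n + 1) ^ 3 \<le> p i"
      unfolding p_def by (rule trans_le_add1)
    then have "spread_sum n \<le> 2 ^ p i"
      using spread_sum_le[of n] power_increasing[of "(n + 1) ^ 3" "p i" "2::nat"] by linarith
    then have "int (spread_sum n) \<le> int (2 ^ p i)"
      by (simp only: of_nat_le_iff)
    then show "\<bar>int (spread_sum n)\<bar> \<le> 2 ^ p i"
      by simp
  qed
  moreover have "\<bar>c N * int low_S\<bar> \<le> \<bar>c N\<bar> * 2 ^ p i"
  proof -
    have "low_S \<le> 2 ^ p i"
      using sum_spread_powers_le[OF N, of "N ^ 3" i] by (simp add: low_S_def p_def)
    then have "int low_S \<le> int (2 ^ p i)"
      by (simp only: of_nat_le_iff)
    then show ?thesis
      by (simp add: abs_mult mult_left_mono)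
  qed
  ultimately have "\<bar>L\<bar> \<le> ((\<Sum>m<p i. \<bar>b m\<bar>) + (\<Sum>n<N. \<bar>c n\<bar>) + \<bar>c N\<bar>) * 2 ^ p i"
    unfolding L_def distrib_right by linarith
  also have "\<dots> \<le> int N * 2 ^ p i"
    using count by (intro mult_right_mono) auto
  finally have L: "\<bar>L\<bar> \<le> int N * 2 ^ p i" .
  have N2: "int N \<le> 2 ^ N - 1"
    using less_exp[of N] by (metis of_nat_less_iff of_nat_numeral of_nat_power zle_diff1_eq)
  have "int N * 2 ^ p i < 2 ^ N * 2 ^ p i"
    using N2 by (intro mult_strict_right_mono) auto
  then have "\<bar>L\<bar> < 2 ^ N * 2 ^ p i"
    using L by linarith
  then have Lj: "\<bar>L\<bar> < 2 ^ j"
    by (simp add: j_def power_add mult.commute)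
  have "\<bar>L + c N * 2 ^ j\<bar> \<le> int N * 2 ^ p i + int N * 2 ^ j"
  proof -
    have "\<bar>c N * 2 ^ j\<bar> \<le> int N * 2 ^ j"
      using cN_le by (simp add: abs_mult mult_right_mono)
    then show ?thesis
      using L by linarith
  qed
  also have "\<dots> = int N * (1 + 2 ^ N) * 2 ^ p i"
    by (simp add: j_def power_add algebra_simps)
  also have "\<dots> \<le> (2 ^ N - 1) * (1 + 2 ^ N) * 2 ^ p i"
    using N2 by (intro mult_right_mono) auto
  also have "\<dots> < 2 ^ (j + N)"
    by (simp add: j_def power_add algebra_simps)
  finally have "L + c N * 2 ^ j = 0"
    using dvd zdvd_not_zless[of "\<bar>L + c N * 2 ^ j\<bar>" "2 ^ (j + N)"] by auto
  then have "\<bar>c N\<bar> * 2 ^ j < 1 * 2 ^ j"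
    using Lj by (simp add: abs_mult eq_neg_iff_add_eq_0[symmetric])
  then show False
    using cN by (simp only: mult_less_cancel_right) auto
qed

section \<open>A topology with prescribed von Neumann radical\<close>

text \<open>
  Near \<open>1\<close>, squaring expands the distance to \<open>1\<close> by the factor \<open>3 / 2\<close>, because
  \<open>v\<^sup>2 - 1 = (v + 1) * (v - 1)\<close> and \<open>v + 1\<close> is close to \<open>2\<close>.
\<close>

lemma unit_eq_one_if_powers_near_one:
  fixes w :: complex
  assumes near: "\<And>k. cmod (w ^ 2 ^ k - 1) \<le> 1 / 2"
  shows "w = 1"
proof (rule ccontr)
  assume "w \<noteq> 1"
  have grow: "(3 / 2) ^ k * cmod (w - 1) \<le> cmod (w ^ 2 ^ k - 1)" for k
  proof (induction k)
    case (Suc k)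
    let ?v = "w ^ 2 ^ k"
    have "3 / 2 \<le> cmod (?v + 1)"
      using norm_triangle_ineq2[of 2 "1 - ?v"] near[of k] by (simp add: norm_minus_commute add.commute)
    have "(3 / 2) ^ Suc k * cmod (w - 1) \<le> 3 / 2 * cmod (?v - 1)"
      using Suc by (simp add: mult.commute)
    also have "\<dots> \<le> cmod (?v + 1) * cmod (?v - 1)"
      using \<open>3 / 2 \<le> cmod (?v + 1)\<close> by (rule mult_right_mono) simp
    also have "\<dots> = cmod (w ^ 2 ^ Suc k - 1)"
    proof -
      have "w ^ 2 ^ Suc k - 1 = (?v + 1) * (?v - 1)"
        by (simp add: algebra_simps mult_2 power_add)
      then show ?thesis
        by (simp add: norm_mult)
    qed
    finally show ?case .
  qed simp
  obtain k where "1 / cmod (w - 1) < (3 / 2) ^ k"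
    using real_arch_pow[of "3 / 2"] by auto
  then have "1 < (3 / 2) ^ k * cmod (w - 1)"
    using \<open>w \<noteq> 1\<close> by (simp add: field_simps)
  then show False
    using grow[of k] near[of k] by linarith
qed

locale twisted_sequence = comm_group G for G (structure) +
  fixes H :: "'a set" and e :: 'a and h :: "nat \<Rightarrow> 'a"
  assumes H: "subgroup H G"
    and e: "e \<in> carrier G"
    and e_independent: "\<And>n::int. e [^] n \<in> H \<Longrightarrow> n = 0"
    and h_in_H: "h n \<in> H"
    and h_recurrent: "x \<in> H \<Longrightarrow> \<exists>n\<ge>m. h n = x"
begin

lemma H_carrier: "x \<in> H \<Longrightarrow> x \<in> carrier G"
  using subgroup.subset[OF H] by blast

lemma h_carrier [simp]: "h n \<in> carrier G"
  by (rule H_carrier[OF h_in_H])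

definition gen_tail :: "nat \<Rightarrow> 'a set" where
  "gen_tail m = (\<lambda>j. e [^] (2 ^ j :: nat)) ` {m..} \<union> (\<lambda>n. h n \<otimes> e [^] spread_sum n) ` {m..}"

definition sym_tail :: "nat \<Rightarrow> 'a set" where
  "sym_tail m = insert \<one> (gen_tail m \<union> m_inv G ` gen_tail m)"

lemma gen_tail_carrier: "gen_tail m \<subseteq> carrier G"
  using e by (auto simp: gen_tail_def)

sublocale shrinking_sets G sym_tail
proof unfold_locales
  show "sym_tail n \<subseteq> carrier G" for n
    using gen_tail_carrier[of n] by (auto simp: sym_tail_def)
  show "\<one> \<in> sym_tail n" for n
    by (simp add: sym_tail_def)
  show "inv x \<in> sym_tail n" if "x \<in> sym_tail n" for x n
    using that gen_tail_carrier[of n] by (auto simp: sym_tail_def)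
  show "sym_tail n \<subseteq> sym_tail m" if "m \<le> n" for m n
    using that by (auto simp: sym_tail_def gen_tail_def)
  show "finite (sym_tail 0 - sym_tail n)" for n
  proof (rule finite_subset)
    define D where "D = (\<lambda>j. e [^] (2 ^ j :: nat)) ` {..<n} \<union> (\<lambda>n. h n \<otimes> e [^] spread_sum n) ` {..<n}"
    have *: "{0..} = {..<n} \<union> {n..}"
      by auto
    have "gen_tail 0 = D \<union> gen_tail n"
      unfolding gen_tail_def D_def * image_Un by (simp only: Un_ac)
    then show "sym_tail 0 - sym_tail n \<subseteq> D \<union> m_inv G ` D"
      unfolding sym_tail_def by (simp only: image_Un) blast
    show "finite (D \<union> m_inv G ` D)"
      by (simp add: D_def)
  qed
qed

definition combination :: "nat \<Rightarrow> (nat \<Rightarrow> int) \<Rightarrow> (nat \<Rightarrow> int) \<Rightarrow> 'a" where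
  "combination B b c =
     (\<Otimes>n\<in>{..<B}. h n [^] c n) \<otimes> e [^] ((\<Sum>m<B. b m * 2 ^ m) + (\<Sum>n<B. c n * int (spread_sum n)))"

text \<open>
  A product of elements \<open>e [^] (2 ^ j)\<close>, \<open>h n \<otimes> e [^] spread_sum n\<close> and their inverses is recorded by its net multiplicities
  \<open>b j\<close> and \<open>c n\<close>; the bound \<open>\<kappa> M\<close> limits the number of factors of index below \<open>M\<close>.
\<close>

definition representable :: "'a \<Rightarrow> (nat \<Rightarrow> nat) \<Rightarrow> bool" where
  "representable x \<kappa> \<longleftrightarrow> (\<exists>B b c. (\<forall>m\<ge>B. b m = 0 \<and> c m = 0) \<and> x = combination B b c \<and>
     (\<forall>M. (\<Sum>m<M. \<bar>b m\<bar>) + (\<Sum>n<M. \<bar>c n\<bar>) \<le> int (\<kappa> M)))"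

lemma combination_extend:
  assumes "\<And>m. m \<ge> B \<Longrightarrow> b m = 0 \<and> c m = 0" and "B \<le> B'"
  shows "combination B' b c = combination B b c"
proof -
  have "(\<Otimes>n\<in>{..<B'}. h n [^] c n) = (\<Otimes>n\<in>{..<B}. h n [^] c n)"
    using assms by (intro finprod_mono_neutral_cong_right) auto
  moreover have "(\<Sum>m<B'. b m * 2 ^ m) = (\<Sum>m<B. b m * 2 ^ m)"
    using assms by (intro sum.mono_neutral_right) auto
  moreover have "(\<Sum>n<B'. c n * int (spread_sum n)) = (\<Sum>n<B. c n * int (spread_sum n))"
    using assms by (intro sum.mono_neutral_right) auto
  ultimately show ?thesis
    by (simp add: combination_def)
qed

lemma combination_add:
  "combination B (\<lambda>m. b m + b' m) (\<lambda>n. c n + c' n) = combination B b c \<otimes> combination B b' c'"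
proof -
  have "(\<Otimes>n\<in>{..<B}. h n [^] (c n + c' n)) = (\<Otimes>n\<in>{..<B}. h n [^] c n) \<otimes> (\<Otimes>n\<in>{..<B}. h n [^] c' n)"
    by (simp add: int_pow_mult)
  moreover have "(\<Sum>m<B. (b m + b' m) * 2 ^ m) + (\<Sum>n<B. (c n + c' n) * int (spread_sum n)) =
    ((\<Sum>m<B. b m * 2 ^ m) + (\<Sum>n<B. c n * int (spread_sum n))) +
    ((\<Sum>m<B. b' m * 2 ^ m) + (\<Sum>n<B. c' n * int (spread_sum n)))"
    by (simp add: distrib_right sum.distrib)
  moreover have "(\<Otimes>n\<in>{..<B}. h n [^] c n) \<in> carrier G" for c :: "nat \<Rightarrow> int"
    by (intro finprod_closed) auto
  ultimately show ?thesis
    using e by (simp add: combination_def int_pow_mult m_ac)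
qed

lemma representable_mult:
  assumes "representable x \<kappa>" and "representable y \<mu>"
  shows "representable (x \<otimes> y) (\<lambda>M. \<kappa> M + \<mu> M)"
proof -
  obtain B b c where x: "\<And>m. m \<ge> B \<Longrightarrow> b m = 0 \<and> c m = 0" "x = combination B b c"
    "\<And>M. (\<Sum>m<M. \<bar>b m\<bar>) + (\<Sum>n<M. \<bar>c n\<bar>) \<le> int (\<kappa> M)"
    using assms(1) unfolding representable_def by blast
  obtain B' b' c' where y: "\<And>m. m \<ge> B' \<Longrightarrow> b' m = 0 \<and> c' m = 0" "y = combination B' b' c'"
    "\<And>M. (\<Sum>m<M. \<bar>b' m\<bar>) + (\<Sum>n<M. \<bar>c' n\<bar>) \<le> int (\<mu> M)"
    using assms(2) unfolding representable_def by blast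
  let ?B = "max B B'"
  have "x \<otimes> y = combination ?B (\<lambda>m. b m + b' m) (\<lambda>n. c n + c' n)"
  proof -
    have "combination ?B b c = x"
      unfolding x(2) by (rule combination_extend) (use x(1) in auto)
    moreover have "combination ?B b' c' = y"
      unfolding y(2) by (rule combination_extend) (use y(1) in auto)
    ultimately show ?thesis
      by (simp only: combination_add)
  qed
  moreover have "(\<Sum>m<M. \<bar>b m + b' m\<bar>) + (\<Sum>n<M. \<bar>c n + c' n\<bar>) \<le> int (\<kappa> M + \<mu> M)" for M
  proof -
    have "(\<Sum>m<M. \<bar>b m + b' m\<bar>) \<le> (\<Sum>m<M. \<bar>b m\<bar>) + (\<Sum>m<M. \<bar>b' m\<bar>)"
      unfolding sum.distrib[symmetric] by (intro sum_mono) auto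
    moreover have "(\<Sum>m<M. \<bar>c m + c' m\<bar>) \<le> (\<Sum>m<M. \<bar>c m\<bar>) + (\<Sum>m<M. \<bar>c' m\<bar>)"
      unfolding sum.distrib[symmetric] by (intro sum_mono) auto
    ultimately show ?thesis
      using x(3)[of M] y(3)[of M] by simp
  qed
  ultimately show ?thesis
    unfolding representable_def using x(1) y(1)
    by (intro exI[of _ ?B] exI[of _ "\<lambda>m. b m + b' m"] exI[of _ "\<lambda>n. c n + c' n"]) auto
qed

lemma representable_one: "representable \<one> (\<lambda>_. 0)"
  unfolding representable_def combination_def
  by (intro exI[of _ 0] exI[of _ "\<lambda>_. 0"]) simp

lemma representable_mono: "representable x \<kappa> \<Longrightarrow> (\<And>M. \<kappa> M \<le> \<mu> M) \<Longrightarrow> representable x \<mu>"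
  unfolding representable_def by (elim exE conjE, intro exI conjI allI) (auto intro: order_trans)

lemma sum_single_le:
  fixes j m :: nat
  assumes "\<bar>\<epsilon>\<bar> = (1::int)" and "m \<le> j"
  shows "(\<Sum>i<M. \<bar>if i = j then \<epsilon> else 0\<bar>) \<le> int (if m < M then 1 else 0)"
proof -
  have "(\<Sum>i<M. \<bar>if i = j then \<epsilon> else 0\<bar>) = (\<Sum>i<M. if i = j then 1 else 0)"
    using assms(1) by (intro sum.cong) auto
  also have "\<dots> = (if j < M then 1 else 0)"
    using sum.delta[of "{..<M}" j "\<lambda>_. 1 :: int"] by simp
  finally show ?thesis
    using assms(2) by simp
qed

lemma representable_power:
  assumes "\<bar>\<epsilon>\<bar> = (1::int)" and "m \<le> j"
  shows "representable (e [^] (\<epsilon> * 2 ^ j)) (\<lambda>M. if m < M then 1 else 0)"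
  unfolding representable_def
proof (intro exI conjI allI impI)
  let ?b = "\<lambda>i. if i = j then \<epsilon> else 0" and ?c = "\<lambda>i::nat. 0::int"
  show "e [^] (\<epsilon> * 2 ^ j) = combination (Suc j) ?b ?c"
    using e by (simp add: combination_def if_distrib[of "\<lambda>x. x * _"] cong: if_cong)
  show "(\<Sum>m<M. \<bar>?b m\<bar>) + (\<Sum>n<M. \<bar>?c n\<bar>) \<le> int (if m < M then 1 else 0)" for M
    using sum_single_le[OF assms, of M] by simp
qed auto

lemma representable_twisted:
  assumes "\<bar>\<epsilon>\<bar> = (1::int)" and "m \<le> j"
  shows "representable (h j [^] \<epsilon> \<otimes> e [^] (\<epsilon> * int (spread_sum j))) (\<lambda>M. if m < M then 1 else 0)"
  unfolding representable_def
proof (intro exI conjI allI impI)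
  let ?c = "\<lambda>i. if i = j then \<epsilon> else 0" and ?b = "\<lambda>i::nat. 0::int"
  have "(\<Otimes>n\<in>{..<Suc j}. h n [^] ?c n) = (\<Otimes>n\<in>{..<Suc j}. if n = j then h n [^] \<epsilon> else \<one>)"
    by (intro finprod_cong') auto
  also have "\<dots> = h j [^] \<epsilon>"
    by (intro finprod_singleton_swap) auto
  finally show "h j [^] \<epsilon> \<otimes> e [^] (\<epsilon> * int (spread_sum j)) = combination (Suc j) ?b ?c"
    using e by (simp add: combination_def if_distrib[of "\<lambda>x. x * _"] cong: if_cong)
  show "(\<Sum>m<M. \<bar>?b m\<bar>) + (\<Sum>n<M. \<bar>?c n\<bar>) \<le> int (if m < M then 1 else 0)" for M
    using sum_single_le[OF assms, of M] by simp
qed auto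

lemma representable_sym_tail:
  assumes "a \<in> sym_tail m"
  shows "representable a (\<lambda>M. if m < M then 1 else 0)"
proof -
  have pow: "g [^] \<epsilon> \<in> {e [^] (\<epsilon> * 2 ^ j) | j. j \<ge> m} \<union> {h n [^] \<epsilon> \<otimes> e [^] (\<epsilon> * int (spread_sum n)) | n. n \<ge> m}"
    if g: "g \<in> gen_tail m" for g and \<epsilon> :: int
  proof -
    consider j where "j \<ge> m" "g = e [^] (2 ^ j :: int)"
      | n where "n \<ge> m" "g = h n \<otimes> e [^] int (spread_sum n)"
      using g unfolding gen_tail_def by (auto simp: int_pow_int simp flip: int_pow_int)
    then show ?thesis
    proof cases
      case 1
      then show ?thesis
        using e by (auto simp: int_pow_pow mult.commute)
    next
      case 2
      then show ?thesis
        using e by (auto simp: int_pow_mult_distrib int_pow_pow m_comm mult.commute)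
    qed
  qed
  consider "a = \<one>" | g where "g \<in> gen_tail m" "a = g [^] (1::int)" | g where "g \<in> gen_tail m" "a = g [^] (-1::int)"
    using assms gen_tail_carrier[of m] by (auto simp: sym_tail_def int_pow_neg)
  then show ?thesis
  proof cases
    case 1
    then show ?thesis
      using representable_mono[OF representable_one] by auto
  next
    case 2
    then show ?thesis
      using pow[of g 1] representable_power[of 1 m] representable_twisted[of 1 m] by auto
  next
    case 3
    then show ?thesis
      using pow[of g "-1"] representable_power[of "-1" m] representable_twisted[of "-1" m] by auto
  qed
qed

text \<open>
  The factor number \<open>i\<close> has an index of at least \<open>s i\<close>, so only the positions with \<open>s i < M\<close> can
  contribute indices below \<open>M\<close>.
\<close>

lemma representable_prods: "x \<in> prods s k \<Longrightarrow> representable x (\<lambda>M. card {i. i < k \<and> s i < M})"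
proof (induction k arbitrary: x)
  case 0
  then show ?case
    using representable_one by simp
next
  case (Suc k)
  then obtain y a where ya: "y \<in> prods s k" "a \<in> sym_tail (s k)" "x = y \<otimes> a"
    by (elim prods_SucE)
  have "card {i. i < Suc k \<and> s i < M} = card {i. i < k \<and> s i < M} + (if s k < M then 1 else 0)" for M
  proof -
    have "{i. i < Suc k \<and> s i < M} = (if s k < M then insert k {i. i < k \<and> s i < M} else {i. i < k \<and> s i < M})"
      by (auto simp: less_Suc_eq)
    then show ?thesis
      by simp
  qed
  then show ?case
    using representable_mult[OF Suc.IH[OF ya(1)] representable_sym_tail[OF ya(2)]] ya(3) by simp
qed

text \<open>
  With this choice of the bounds, a product has at most \<open>N\<close> factors of index below \<open>(N + 1) ^ 3\<close>,
  which is the sparsity that \<open>sparse_relation_trivial\<close> asks for. Independence of \<open>e\<close> and \<open>H\<close> supplies the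
  relation itself.
\<close>

lemma nbhd_inter_H: "nbhd (\<lambda>i. (i + 1) ^ 3) \<inter> H \<subseteq> {\<one>}"
proof
  fix x assume x: "x \<in> nbhd (\<lambda>i. (i + 1) ^ 3) \<inter> H"
  then obtain k where "x \<in> prods (\<lambda>i. (i + 1) ^ 3) k"
    by (auto simp: nbhd_def)
  then obtain B b c where supp: "\<And>m. m \<ge> B \<Longrightarrow> b m = 0 \<and> c m = 0" and xc: "x = combination B b c"
    and sum: "\<And>M. (\<Sum>m<M. \<bar>b m\<bar>) + (\<Sum>n<M. \<bar>c n\<bar>) \<le> int (card {i. i < k \<and> (i + 1) ^ 3 < M})"
    using representable_prods unfolding representable_def by blast
  have sparse: "(\<Sum>m<(N + 1) ^ 3. \<bar>b m\<bar>) + (\<Sum>n<(N + 1) ^ 3. \<bar>c n\<bar>) \<le> int N" for N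
  proof -
    have "{i. i < k \<and> (i + 1) ^ 3 < (N + 1) ^ 3} \<subseteq> {..<N}"
      using power_less_imp_less_base[of _ 3 "N + 1"] by auto
    then have "card {i. i < k \<and> (i + 1) ^ 3 < (N + 1) ^ 3} \<le> N"
      using card_mono[of "{..<N}"] by fastforce
    then show ?thesis
      using sum[of "(N + 1) ^ 3"] by linarith
  qed
  define z where "z = (\<Sum>m<B. b m * 2 ^ m) + (\<Sum>n<B. c n * int (spread_sum n))"
  define p where "p = (\<Otimes>n\<in>{..<B}. h n [^] c n)"
  have "(\<Otimes>n\<in>{..<l}. h n [^] c n) \<in> H" for l
  proof (induction l)
    case 0
    then show ?case
      by (simp add: subgroup.one_closed[OF H])
  next
    case (Suc l)
    then show ?case
      using subgroup.m_closed[OF H] subgroup_int_pow_closed[OF H h_in_H]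
      by (simp add: lessThan_Suc)
  qed
  then have p: "p \<in> H"
    by (simp add: p_def)
  have xpz: "x = p \<otimes> e [^] z"
    by (simp add: xc combination_def p_def z_def)
  then have "e [^] z = inv p \<otimes> x"
    using p H_carrier e by (simp add: m_assoc[symmetric])
  then have "e [^] z \<in> H"
    using x p by (simp add: subgroup.m_closed[OF H] subgroup.m_inv_closed[OF H])
  then have "z = 0"
    by (rule e_independent)
  then have "c n = 0" for n
    using sparse_relation_trivial[OF _ supp sparse] unfolding z_def by blast
  then have "p = \<one>"
    by (simp add: p_def)
  then show "x \<in> {\<one>}"
    using \<open>z = 0\<close> xpz by simp
qed

text \<open>
  Open subgroups that decrease to \<open>H\<close>; they are generated by \<open>H\<close> and \<open>e [^] (2 ^ m)\<close>.
\<close>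

definition radical_approx :: "nat \<Rightarrow> 'a set" where
  "radical_approx m = H <#> generate G {e [^] (2 ^ m :: nat)}"

lemma subgroup_radical_approx: "subgroup (radical_approx m) G"
  unfolding radical_approx_def using e by (intro mult_subgroups H generate_is_subgroup) auto

lemma in_radical_approx_iff:
  "x \<in> radical_approx m \<longleftrightarrow> (\<exists>y\<in>H. \<exists>k::int. x = y \<otimes> e [^] (2 ^ m * k))"
proof -
  have "generate G {e [^] (2 ^ m :: nat)} = {e [^] (2 ^ m * k) | k::int. True}"
    using e by (simp add: generate_pow int_pow_pow flip: int_pow_int)
  then show ?thesis
    by (auto simp: radical_approx_def set_mult_def)
qed

lemma nbhd_subset_radical_approx: "nbhd (\<lambda>_. m) \<subseteq> radical_approx m"
proof -
  have "gen_tail m \<subseteq> radical_approx m"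
  proof
    fix g assume "g \<in> gen_tail m"
    then consider j where "j \<ge> m" "g = e [^] (2 ^ j :: nat)" | n where "n \<ge> m" "g = h n \<otimes> e [^] spread_sum n"
      by (auto simp: gen_tail_def)
    then show "g \<in> radical_approx m"
    proof cases
      case 1
      then have "g = \<one> \<otimes> e [^] (2 ^ m * 2 ^ (j - m) :: int)"
        using e by (simp add: flip: power_add int_pow_int)
      then show ?thesis
        using subgroup.one_closed[OF H] in_radical_approx_iff by blast
    next
      case 2
      then obtain q where "spread_sum n = 2 ^ m * q"
        using power_dvd_spread_sum by blast
      then have "g = h n \<otimes> e [^] (2 ^ m * int q)"
        using 2 by (simp flip: int_pow_int)
      then show ?thesis
        using h_in_H in_radical_approx_iff by blast
    qed
  qed
  then have "sym_tail m \<subseteq> radical_approx m"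
    using subgroup.one_closed[OF subgroup_radical_approx] subgroup.m_inv_closed[OF subgroup_radical_approx]
    by (auto simp: sym_tail_def)
  then have "x \<in> radical_approx m" if "x \<in> prods (\<lambda>_. m) k" for x k
    using that
    by (induction k arbitrary: x)
      (auto elim!: prods_SucE intro: subgroup.m_closed[OF subgroup_radical_approx] subgroup.one_closed[OF subgroup_radical_approx])
  then show ?thesis
    by (auto simp: nbhd_def)
qed

lemma e_pow_eq: "e [^] (k::int) = e [^] l \<Longrightarrow> k = l"
proof -
  assume "e [^] k = e [^] l"
  then have "e [^] (k - l) = \<one>"
    using e by (simp add: int_pow_diff)
  then show "k = l"
    using e_independent[of "k - l"] subgroup.one_closed[OF H] by simp
qed

text \<open>
  The exponent of \<open>e\<close> is determined by \<open>x\<close> and is divisible by all powers of two, hence zero.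
\<close>

lemma Inter_radical_approx:
  assumes "\<And>m. x \<in> radical_approx m"
  shows "x \<in> H"
proof -
  obtain y k where y: "y \<in> H" "x = y \<otimes> e [^] (k::int)"
    using assms[of 0] by (auto simp: in_radical_approx_iff)
  have "2 ^ m dvd k" for m
  proof -
    obtain y' k' where y': "y' \<in> H" "x = y' \<otimes> e [^] (2 ^ m * k' :: int)"
      using assms[of m] in_radical_approx_iff by blast
    have c: "y \<in> carrier G" "y' \<in> carrier G"
      using y y' H_carrier by auto
    have "y' = y \<otimes> e [^] k \<otimes> inv (e [^] (2 ^ m * k'))"
      using y(2) y'(2) c e by (simp add: inv_solve_right)
    also have "\<dots> = y \<otimes> e [^] (k - 2 ^ m * k')"
      using c e by (simp add: int_pow_diff m_assoc)
    finally have "e [^] (k - 2 ^ m * k') = inv y \<otimes> y'"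
      using c e by (simp add: m_assoc[symmetric])
    then have "e [^] (k - 2 ^ m * k') \<in> H"
      using y y' by (simp add: subgroup.m_closed[OF H] subgroup.m_inv_closed[OF H])
    then have "k - 2 ^ m * k' = 0"
      by (rule e_independent)
    then show ?thesis
      by simp
  qed
  then have "2 ^ nat \<bar>k\<bar> dvd k"
    by blast
  moreover have "\<bar>k\<bar> < 2 ^ nat \<bar>k\<bar>"
    using less_exp[of "nat \<bar>k\<bar>"] by (metis abs_ge_zero int_nat_eq nat_less_iff of_nat_numeral of_nat_power of_nat_less_iff)
  ultimately have "k = 0"
    using zdvd_not_zless[of "\<bar>k\<bar>" "2 ^ nat \<bar>k\<bar>"] by auto
  then show ?thesis
    using y H_carrier by simp
qed

lemma Hausdorff_space_twisted_topology: "Hausdorff_space base_topology"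
proof (rule Hausdorff_space_base_topology)
  fix x assume x: "x \<in> carrier G" "x \<noteq> \<one>"
  show "\<exists>s. x \<notin> nbhd s"
  proof (cases "x \<in> H")
    case True
    then show ?thesis
      using nbhd_inter_H x by blast
  next
    case False
    then obtain m where "x \<notin> radical_approx m"
      using Inter_radical_approx by blast
    then show ?thesis
      using nbhd_subset_radical_approx by blast
  qed
qed

lemma twisted_topology_not_discrete: "base_topology \<noteq> discrete_topology (carrier G)"
proof
  assume "base_topology = discrete_topology (carrier G)"
  then have "openin base_topology {\<one>}"
    by simp
  then obtain s where s: "\<And>u. u \<in> nbhd s \<Longrightarrow> \<one> \<otimes> u \<in> {\<one>}"
    using openin_base_topologyD[of "{\<one>}" \<one>] by blast
  have "e [^] (2 ^ s 0 :: nat) \<in> nbhd s"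
    using A_subset_nbhd[of s] by (auto simp: sym_tail_def gen_tail_def)
  then have "e [^] (2 ^ s 0 :: nat) = \<one>"
    using s[of "e [^] (2 ^ s 0 :: nat)"] e by simp
  then have "e [^] (2 ^ s 0 :: int) = e [^] (0::int)"
    by (simp flip: int_pow_int)
  then show False
    using e_pow_eq by fastforce
qed

lemma continuous_character_if_trivial_on_nbhd:
  assumes f: "f \<in> hom G circle_group" and triv: "\<And>u. u \<in> nbhd s \<Longrightarrow> f u = 1"
  shows "f \<in> continuous_characters G base_topology"
proof -
  have f_mult: "f (x \<otimes> u) = f x" if "x \<in> carrier G" "u \<in> nbhd s" for x u
    using hom_mult[OF f that(1) in_nbhd_carrier[OF that(2)]] triv[OF that(2)]
    by (simp add: circle_group_def)
  have "openin base_topology {x \<in> carrier G. f x \<in> W}" for W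
    unfolding openin_base_topology
  proof (intro conjI ballI exI)
    fix x assume "x \<in> {x \<in> carrier G. f x \<in> W}"
    then show "x <# nbhd s \<subseteq> {x \<in> carrier G. f x \<in> W}"
      using f_mult in_nbhd_carrier by (auto simp: l_coset_def)
  qed auto
  moreover have "f x \<in> carrier circle_group" if "x \<in> carrier G" for x
    using f that by (auto simp: hom_def)
  ultimately show ?thesis
    using f by (auto simp: continuous_characters_def continuous_map_def)
qed

lemma continuous_character_near_one:
  assumes f: "f \<in> continuous_characters G base_topology" and "\<epsilon> > 0"
  obtains s where "\<And>u. u \<in> nbhd s \<Longrightarrow> cmod (f u - 1) < \<epsilon>"
proof -
  have hom: "f \<in> hom G circle_group" and cont: "continuous_map base_topology (top_of_set (carrier circle_group)) f"
    using f by (auto simp: continuous_characters_def)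
  have "openin (top_of_set (carrier circle_group)) (carrier circle_group \<inter> ball 1 \<epsilon>)"
    by (simp add: openin_open_Int)
  then have "openin base_topology {x \<in> carrier G. f x \<in> carrier circle_group \<inter> ball 1 \<epsilon>}"
    using cont by (auto simp: continuous_map_def)
  moreover have "f \<one> = 1"
    using hom_one[OF hom is_group group_circle_group] by (simp add: circle_group_def)
  ultimately obtain s where "\<And>u. u \<in> nbhd s \<Longrightarrow> \<one> \<otimes> u \<in> {x \<in> carrier G. f x \<in> carrier circle_group \<inter> ball 1 \<epsilon>}"
    using \<open>\<epsilon> > 0\<close> by (elim openin_base_topologyD) (auto simp: circle_group_def)
  then have "cmod (f u - 1) < \<epsilon>" if "u \<in> nbhd s" for u
    using that in_nbhd_carrier by (force simp: dist_norm norm_minus_commute)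
  then show thesis
    using that by blast
qed

text \<open>
  Continuity forces \<open>f e\<close> to have a power of two as its order, so \<open>f\<close> no longer sees
  \<open>e [^] spread_sum n\<close> for large \<open>n\<close>, and \<open>h n = x\<close> happens for arbitrarily large \<open>n\<close>.
\<close>

lemma character_trivial_on_H:
  assumes f: "f \<in> continuous_characters G base_topology" and x: "x \<in> H"
  shows "f x = 1"
proof -
  have hom: "f \<in> hom G circle_group"
    using f by (auto simp: continuous_characters_def)
  have pow: "f (y [^] k) = f y ^ k" if y: "y \<in> carrier G" for y and k :: nat
  proof (induction k)
    case 0
    then show ?case
      using hom_one[OF hom is_group group_circle_group] by (simp add: circle_group_def)
  next
    case (Suc k)
    then show ?case
      using hom_mult[OF hom, of "y [^] k" y] y by (simp add: circle_group_def)
  qed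
  obtain s where s: "\<And>u. u \<in> nbhd s \<Longrightarrow> cmod (f u - 1) < 1 / 2"
    using continuous_character_near_one[OF f, of "1 / 2"] by auto
  define m where "m = s 0"
  have "f e ^ 2 ^ m = 1"
  proof (rule unit_eq_one_if_powers_near_one)
    fix k
    have "e [^] (2 ^ (m + k) :: nat) \<in> nbhd s"
      using A_subset_nbhd[of s] by (auto simp: sym_tail_def gen_tail_def m_def)
    then have "cmod (f (e [^] (2 ^ (m + k) :: nat)) - 1) < 1 / 2"
      by (rule s)
    then show "cmod ((f e ^ 2 ^ m) ^ 2 ^ k - 1) \<le> 1 / 2"
      by (simp add: pow[OF e] power_add power_mult)
  qed
  then have S: "f (e [^] spread_sum n) = 1" if "n \<ge> m" for n
    using power_dvd_spread_sum[OF that] by (auto simp: pow[OF e] power_mult)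
  have "cmod (f x - 1) \<le> 0 + \<epsilon>" if \<epsilon>: "\<epsilon> > 0" for \<epsilon>
  proof -
    obtain t where t: "\<And>u. u \<in> nbhd t \<Longrightarrow> cmod (f u - 1) < \<epsilon>"
      using continuous_character_near_one[OF f \<epsilon>] by auto
    obtain n where n: "n \<ge> max m (t 0)" "h n = x"
      using h_recurrent[OF x] by blast
    then have "x \<otimes> e [^] spread_sum n \<in> nbhd t"
      using A_subset_nbhd[of t] by (auto simp: sym_tail_def gen_tail_def)
    moreover have "f (x \<otimes> e [^] spread_sum n) = f x"
      using hom_mult[OF hom H_carrier[OF x], of "e [^] spread_sum n"] S[of n] n e by (simp add: circle_group_def)
    ultimately show ?thesis
      using t by fastforce
  qed
  then have "cmod (f x - 1) \<le> 0"
    by (rule field_le_epsilon)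
  then show ?thesis
    by simp
qed

lemma von_neumann_radical_eq: "von_neumann_radical G base_topology = H"
proof
  have one: "\<one>\<^bsub>circle_group\<^esub> = 1"
    by (simp add: circle_group_def)
  show "H \<subseteq> von_neumann_radical G base_topology"
    using character_trivial_on_H H_carrier by (auto simp: von_neumann_radical_def kernel_def one)
  show "von_neumann_radical G base_topology \<subseteq> H"
  proof
    fix x assume x: "x \<in> von_neumann_radical G base_topology"
    \<comment> \<open>An intersection over no characters at all would not be confined to the carrier.\<close>
    have "(\<lambda>_. 1) \<in> continuous_characters G base_topology"
      by (rule continuous_character_if_trivial_on_nbhd) (auto simp: hom_def circle_group_def)
    then have xG: "x \<in> carrier G"
      using x by (auto simp: von_neumann_radical_def kernel_def)
    show "x \<in> H"
    proof (rule Inter_radical_approx, rule ccontr)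
      fix m assume "x \<notin> radical_approx m"
      then obtain f where f: "f \<in> hom G circle_group" "\<And>y. y \<in> radical_approx m \<Longrightarrow> f y = 1" "f x \<noteq> 1"
        using character_separating_subgroup_from_point[OF subgroup_radical_approx xG] by blast
      have "f \<in> continuous_characters G base_topology"
        using f(1) f(2)[OF subsetD[OF nbhd_subset_radical_approx]] by (rule continuous_character_if_trivial_on_nbhd)
      then show False
        using x f(3) by (auto simp: von_neumann_radical_def kernel_def one)
    qed
  qed
qed

lemma H_in_NRC: "H \<in> NRC G"
  unfolding NRC_def
  using H group_topology_base_topology Hausdorff_space_twisted_topology complete_base_topology twisted_topology_not_discrete
    von_neumann_radical_eq by blast

end

theorem corollary4:
  fixes G :: "('a, 'b) monoid_scheme" (structure) and H :: "'a set"
  assumes "comm_group G" and "infinite (carrier G)"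
    and "subgroup H G" and "countable H"
    and "\<exists>e\<^sub>0 \<in> carrier G. group.ord G e\<^sub>0 = 0 \<and> generate G {e\<^sub>0} \<inter> H = {\<one>}"
  shows "H \<in> NRC G"
proof -
  interpret comm_group G by fact
  obtain e where e: "e \<in> carrier G" "ord e = 0" "generate G {e} \<inter> H = {\<one>}"
    using assms(5) by blast
  have independent: "n = 0" if "e [^] n \<in> H" for n :: int
  proof -
    have "e [^] n \<in> generate G {e}"
      using generate_pow[OF e(1)] by blast
    then have "e [^] n = \<one>"
      using that e(3) by blast
    then show ?thesis
      using e(1,2) by (simp add: int_pow_eq_id)
  qed
  \<comment> \<open>Forgetting one component of a pairing repeats every value infinitely often.\<close>
  define h where "h n = from_nat_into H (fst (prod_decode n))" for n
  have ne: "H \<noteq> {}"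
    using subgroup.one_closed[OF assms(3)] by blast
  have recurrent: "\<exists>n\<ge>m. h n = x" if x: "x \<in> H" for x m
  proof -
    obtain k where "from_nat_into H k = x"
      using from_nat_into_surj[OF assms(4) x] by blast
    then show ?thesis
      using le_prod_encode_2[of m k] by (intro exI[of _ "prod_encode (k, m)"]) (simp add: h_def)
  qed
  interpret twisted_sequence G H e h
  proof (intro twisted_sequence.intro twisted_sequence_axioms.intro comm_group_axioms)
    show "h n \<in> H" for n
      using from_nat_into[OF ne] by (simp add: h_def)
  qed (fact assms(3) e(1) independent recurrent)+
  show ?thesis
    by (rule H_in_NRC)
qed

end
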